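(* Let $d\ge 1$. There are a constant $M_d>0$ and $k\in\mathbb{N}$ such that, with high probability, $\mathrm{mlt}(G(n,M_d(\log n)^k/n))\ge d$.
   Context: $G(n,p)$ is the Erdős–Rényi random graph on $n$ vertices with each edge present independently with probability $p$; "with high probability" means with probability tending to $1$ as $n\to\infty$. For a graph $G$ on $\{1,\dots,n\}$: the MLE of the Gaussian graphical model of $G$ from data $X_1,\dots,X_N\in\mathbb{R}^n$, $S=\frac1N\sum X_kX_k^T$, exists if the minimum of $\operatorname{tr}(SK)-\log\det K$ over positive definite $K$ with $K_{ij}=0$ for non-edges $ij$ ($i\ne j$) is attained; $\mathrm{mlt}(G)$ is the smallest $N$ such that for i.i.d. samples from a distribution mutually absolutely continuous with respect to Lebesgue measure the MLE exists almost surely. *)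

theory Defs
  imports
    "HOL-Probability.Probability"
    "Jordan_Normal_Form.Determinant"
begin

(* A graph on n vertices is its edge set, a set of two-element subsets of the vertex set {..<n};
   vertices are numbered from 0, as are the rows and columns of a Jordan_Normal_Form matrix.
   Several names (mat, det, ...) exist in HOL-Analysis as well and are therefore qualified. *)

definition all_edges :: "nat \<Rightarrow> nat set set" where
  "all_edges n = {e. e \<subseteq> {..<n} \<and> card e = 2}"

(* bernoulli_pmf truncates its parameter to [0, 1]. *)
definition erdos_renyi :: "nat \<Rightarrow> real \<Rightarrow> nat set set pmf" where
  "erdos_renyi n p =
     map_pmf (\<lambda>f. {e \<in> all_edges n. f e}) (Pi_pmf (all_edges n) False (\<lambda>_. bernoulli_pmf p))"

definition pos_def :: "nat \<Rightarrow> real mat \<Rightarrow> bool" where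
  "pos_def n K \<longleftrightarrow> K \<in> carrier_mat n n \<and> transpose_mat K = K \<and>
     (\<forall>v \<in> carrier_vec n. v \<noteq> 0\<^sub>v n \<longrightarrow> scalar_prod v (K *\<^sub>v v) > 0)"

definition mat_trace :: "real mat \<Rightarrow> real" where
  "mat_trace A = (\<Sum>i<dim_row A. A $$ (i, i))"

definition concentration_mats :: "nat \<Rightarrow> nat set set \<Rightarrow> real mat set" where
  "concentration_mats n E =
     {K. pos_def n K \<and> (\<forall>i<n. \<forall>j<n. i \<noteq> j \<and> {i, j} \<notin> E \<longrightarrow> K $$ (i, j) = 0)}"

(* X k i is the i-th coordinate of the k-th data point; the matrix is (1/N) * sum of X_k X_k^T. *)
definition sample_cov :: "nat \<Rightarrow> nat \<Rightarrow> (nat \<Rightarrow> nat \<Rightarrow> real) \<Rightarrow> real mat" where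
  "sample_cov n N X = Matrix.mat n n (\<lambda>(i, j). (\<Sum>k<N. X k i * X k j) / real N)"

definition neg_log_lik :: "real mat \<Rightarrow> real mat \<Rightarrow> real" where
  "neg_log_lik S K = mat_trace (S * K) - ln (Determinant.det K)"

definition mle_exists :: "nat \<Rightarrow> nat set set \<Rightarrow> nat \<Rightarrow> (nat \<Rightarrow> nat \<Rightarrow> real) \<Rightarrow> bool" where
  "mle_exists n E N X \<longleftrightarrow>
     (\<exists>K \<in> concentration_mats n E. \<forall>K' \<in> concentration_mats n E.
        neg_log_lik (sample_cov n N X) K \<le> neg_log_lik (sample_cov n N X) K')"

(* Lebesgue (Borel) measure on R^n, whose points are the extensional functions on {..<n} *)
abbreviation lebesgue_n :: "nat \<Rightarrow> (nat \<Rightarrow> real) measure" where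
  "lebesgue_n n \<equiv> Pi\<^sub>M {..<n} (\<lambda>_. lborel)"

definition ac_distribution :: "nat \<Rightarrow> (nat \<Rightarrow> real) measure \<Rightarrow> bool" where
  "ac_distribution n \<mu> \<longleftrightarrow> prob_space \<mu> \<and> sets \<mu> = sets (lebesgue_n n) \<and>
     absolutely_continuous (lebesgue_n n) \<mu> \<and> absolutely_continuous \<mu> (lebesgue_n n)"

(* N i.i.d. samples from \<mu> have joint law Pi\<^sub>M {..<N} (\<lambda>_. \<mu>). *)
definition mle_exists_as :: "nat \<Rightarrow> nat set set \<Rightarrow> nat \<Rightarrow> bool" where
  "mle_exists_as n E N \<longleftrightarrow>
     (\<forall>\<mu>. ac_distribution n \<mu> \<longrightarrow> (AE X in Pi\<^sub>M {..<N} (\<lambda>_. \<mu>). mle_exists n E N X))"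

(* S = (1/N) * ... only makes sense for N > 0. *)
definition mlt :: "nat \<Rightarrow> nat set set \<Rightarrow> nat" where
  "mlt n E = (LEAST N. 0 < N \<and> mle_exists_as n E N)"

end

theory Submission
  imports Defs "HOL-Real_Asymp.Real_Asymp"
begin

text \<open>If some nonzero positive semidefinite \<open>K\<close> with the sparsity pattern of the graph annihilates all
  \<open>N\<close> samples, then moving in the direction \<open>K\<close> leaves the trace term constant and increases the
  determinant, so the MLE does not exist. It is enough to find such a \<open>K\<close> for all data in a small
  box. Split (most of) the vertices into \<open>N\<close> blocks and let the data matrix have the indicator
  vectors of the blocks as its columns: if every block induces a connected graph, the sum of the
  block Laplacians is such a \<open>K\<close>, of corank exactly \<open>N\<close>. If moreover the bipartite graph
  between any two blocks is connected, the data are infinitesimally rigid, and \<open>K\<close> can be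
  corrected for all nearby data, where it stays positive semidefinite. In \<open>G(n, C log n / n)\<close> a
  union bound over cuts gives all these connectivity properties with high probability.\<close>

section \<open>Determinants of positive definite matrices\<close>

text \<open>\<open>mlt\<close> is a \<open>LEAST\<close>, so refuting every sample size below
  \<open>d\<close> gives nothing until some size is known to qualify; hence existence of the MLE for
  \<open>n\<close> samples is proved too. The refutation must cover data of positive measure, while
  the block Laplacians give a stress at one point \<open>x\<close> only. For at least two blocks the
  map from K to K x is never onto there: x^T K x is symmetric. Adding x A with antisymmetric A
  removes exactly this obstruction, and rigidity means that the enlarged map is onto. For nearby
  data one then only solves a linear system close to the identity, instead of invoking an implicit
  function theorem, and symmetry makes the extra term vanish afterwards. Positivity survives because
  the corrected matrix annihilates the data exactly: only vectors vanishing at one chosen vertex per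
  block remain to be tested, and on them the Laplacian is coercive. The constants are
  \<open>k = 1\<close> and \<open>M = 8 d\<close>: blocks have at least n/(2d) vertices, so a cut
  with u vertices on its small side stays uncrossed with probability at most n^(-2u), which beats
  the number of such cuts.\<close>

lemma det_nonzero_inverse:
  fixes M :: "'a::field mat"
  assumes M: "M \<in> carrier_mat k k" and det: "Determinant.det M \<noteq> 0"
  obtains B where "B \<in> carrier_mat k k" "M * B = 1\<^sub>m k" "B * M = 1\<^sub>m k"
proof -
  have "M \<in> Units (ring_mat TYPE('a) k ())" by (rule det_non_zero_imp_unit[OF M det])
  then show ?thesis using that unfolding Units_def ring_mat_def by auto
qed

lemma finite_abs_bound:
  fixes f :: "'a \<Rightarrow> real"
  assumes "finite S" shows "\<exists>B\<ge>0. \<forall>s\<in>S. \<bar>f s\<bar> \<le> B"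
proof (intro exI[of _ "\<Sum>s\<in>S. \<bar>f s\<bar>"] conjI ballI)
  fix s assume "s \<in> S"
  then show "\<bar>f s\<bar> \<le> (\<Sum>s\<in>S. \<bar>f s\<bar>)"
    using assms by (intro member_le_sum[of s S "\<lambda>s. \<bar>f s\<bar>"]) auto
qed (simp add: sum_nonneg)

text \<open>On s e_i + t e_j the form is a binary quadratic form in s and t. If its s^2 coefficient
  vanishes, then for t = 1 it is affine in s and bounded below, so its slope vanishes as
  well.\<close>

lemma psd_on_diagonal:
  fixes A :: "nat \<Rightarrow> nat \<Rightarrow> real"
  assumes fin: "finite I" and i: "i \<in> I"
    and sym: "\<And>i j. A i j = A j i"
    and psd: "\<And>v. 0 \<le> (\<Sum>i\<in>I. \<Sum>j\<in>I. v i * A i j * v j)"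
  shows "0 \<le> A i i" and "A i i = 0 \<Longrightarrow> j \<in> I \<Longrightarrow> A i j = 0"
proof -
  have two: "(\<Sum>k\<in>I. \<Sum>l\<in>I. (s * of_bool (k = i) + t * of_bool (k = j)) * A k l * (s * of_bool (l = i) + t * of_bool (l = j)))
     = s\<^sup>2 * A i i + 2 * s * t * A i j + t\<^sup>2 * A j j" if "j \<in> I" for j s t
  proof -
    have 1: "(\<Sum>l\<in>I. f l * (s * of_bool (l = i) + t * of_bool (l = j))) = f i * s + f j * t" for f :: "nat \<Rightarrow> real"
    proof -
      have "(\<Sum>l\<in>I. f l * (s * of_bool (l = i) + t * of_bool (l = j))) =
         (\<Sum>l\<in>I. (if l = i then f i * s else 0) + (if l = j then f j * t else 0))"
        by (intro sum.cong) (auto simp: algebra_simps)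
      then show ?thesis using fin i that by (simp add: sum.distrib sum.delta)
    qed
    have "(\<Sum>k\<in>I. \<Sum>l\<in>I. (s * of_bool (k = i) + t * of_bool (k = j)) * A k l * (s * of_bool (l = i) + t * of_bool (l = j)))
      = (\<Sum>k\<in>I. (A k i * s + A k j * t) * (s * of_bool (k = i) + t * of_bool (k = j)))"
      by (intro sum.cong refl, subst 1) (simp add: algebra_simps)
    also note 1
    finally show ?thesis using sym[of j i] by (simp add: algebra_simps power2_eq_square)
  qed
  show "0 \<le> A i i" using psd[of "\<lambda>k. 1 * of_bool (k = i) + 0 * of_bool (k = i)"] unfolding two[OF i] by simp
  show "A i j = 0" if "A i i = 0" "j \<in> I"
  proof (rule ccontr)
    assume ne: "A i j \<noteq> 0"
    have "0 \<le> 2 * s * A i j + A j j" for s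
      using psd[of "\<lambda>k. s * of_bool (k = i) + 1 * of_bool (k = j)"]
      unfolding two[OF that(2)] that(1) by simp
    \<comment> \<open>At this \<open>s\<close> the affine function takes the value -1.\<close>
    from this[of "- (A j j + 1) / (2 * A i j)"] ne show False by (simp add: field_simps)
  qed
qed

text \<open>The Schur complement of a positive pivot is again positive semidefinite, because its
  form is the minimum of the original form over coordinate \<open>i\<close>.\<close>

lemma psd_on_pivot:
  fixes A :: "nat \<Rightarrow> nat \<Rightarrow> real"
  assumes fin: "finite I" and i: "i \<in> I"
    and sym: "\<And>i j. A i j = A j i"
    and psd: "\<And>v. 0 \<le> (\<Sum>i\<in>I. \<Sum>j\<in>I. v i * A i j * v j)"
    and pos: "A i i > 0"
  shows "0 \<le> (\<Sum>k\<in>I-{i}. \<Sum>l\<in>I-{i}. v k * (A k l - A i k * A i l / A i i) * v l)"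
proof -
  define J where "J = I - {i}"
  have finJ: "finite J" using fin by (simp add: J_def)
  define m where "m = (\<Sum>l\<in>J. A i l * v l)"
  \<comment> \<open>Coordinate \<open>i\<close> is put at the minimiser, the other coordinates being
    fixed.\<close>
  define w where "w = v(i := - m / A i i)"
  have S: "(\<Sum>k\<in>I. f k) = f i + (\<Sum>k\<in>J. f k)" for f :: "nat \<Rightarrow> real"
    using sum.remove[OF fin i] by (simp add: J_def)
  have wJ: "w k = v k" if "k \<in> J" for k using that by (auto simp: w_def J_def)
  have "(\<Sum>k\<in>I. \<Sum>l\<in>I. w k * A k l * w l)
     = w i * A i i * w i + (\<Sum>l\<in>J. w i * A i l * w l)
       + (\<Sum>k\<in>J. w k * A k i * w i + (\<Sum>l\<in>J. w k * A k l * w l))"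
    unfolding S ..
  also have "(\<Sum>l\<in>J. w i * A i l * w l) = w i * m"
    unfolding m_def sum_distrib_left by (intro sum.cong) (auto simp: wJ)
  also have "(\<Sum>k\<in>J. w k * A k i * w i + (\<Sum>l\<in>J. w k * A k l * w l))
     = w i * m + (\<Sum>k\<in>J. \<Sum>l\<in>J. v k * A k l * v l)"
  proof -
    have "(\<Sum>k\<in>J. w k * A k i * w i) = w i * m"
      unfolding m_def sum_distrib_left by (intro sum.cong) (auto simp: wJ sym[of _ i])
    moreover have "(\<Sum>k\<in>J. \<Sum>l\<in>J. w k * A k l * w l) = (\<Sum>k\<in>J. \<Sum>l\<in>J. v k * A k l * v l)"
      by (intro sum.cong) (auto simp: wJ)
    ultimately show ?thesis by (simp add: sum.distrib)
  qed
  also have "w i * A i i * w i + w i * m + (w i * m + (\<Sum>k\<in>J. \<Sum>l\<in>J. v k * A k l * v l))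
     = (\<Sum>k\<in>J. \<Sum>l\<in>J. v k * A k l * v l) - m * m / A i i"
    using pos by (simp add: w_def field_simps)
  also have "m * m / A i i = (\<Sum>k\<in>J. \<Sum>l\<in>J. v k * (A i k * A i l / A i i) * v l)"
    unfolding m_def sum_product sum_divide_distrib by (intro sum.cong) auto
  also have "(\<Sum>k\<in>J. \<Sum>l\<in>J. v k * A k l * v l) - (\<Sum>k\<in>J. \<Sum>l\<in>J. v k * (A i k * A i l / A i i) * v l)
     = (\<Sum>k\<in>J. \<Sum>l\<in>J. v k * (A k l - A i k * A i l / A i i) * v l)"
    unfolding sum_subtractf[symmetric] by (intro sum.cong) (auto simp: algebra_simps)
  finally show ?thesis using psd[of w] by (simp add: J_def)
qed

lemma scalar_prod_mat_vec:
  fixes K :: "real mat"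
  assumes "K \<in> carrier_mat n n" "v \<in> carrier_vec n" "w \<in> carrier_vec n"
  shows "scalar_prod w (K *\<^sub>v v) = (\<Sum>i<n. \<Sum>j<n. w $ i * K $$ (i, j) * v $ j)"
  using assms by (simp add: scalar_prod_def lessThan_atLeast0 sum_distrib_left mult.assoc)

text \<open>With plain functions in place of vectors, test vectors can be written as formulas and
  positivity becomes a matter of finite sums.\<close>

lemma pos_def_iff:
  "pos_def n K \<longleftrightarrow> K \<in> carrier_mat n n \<and> (\<forall>i<n. \<forall>j<n. K $$ (i, j) = K $$ (j, i)) \<and>
     (\<forall>v. (\<exists>i<n. v i \<noteq> 0) \<longrightarrow> (\<Sum>i<n. \<Sum>j<n. v i * K $$ (i, j) * v j) > 0)" (is "?L \<longleftrightarrow> ?R")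
proof (cases "K \<in> carrier_mat n n")
  case K: True
  have sym: "transpose_mat K = K \<longleftrightarrow> (\<forall>i<n. \<forall>j<n. K $$ (i, j) = K $$ (j, i))"
    using K by (auto simp: mat_eq_iff)
  have "(\<forall>v \<in> carrier_vec n. v \<noteq> 0\<^sub>v n \<longrightarrow> scalar_prod v (K *\<^sub>v v) > 0) \<longleftrightarrow>
      (\<forall>v. (\<exists>i<n. v i \<noteq> 0) \<longrightarrow> (\<Sum>i<n. \<Sum>j<n. v i * K $$ (i, j) * v j) > 0)" (is "?A \<longleftrightarrow> ?B")
  proof
    assume A: ?A
    show ?B
    proof (intro allI impI)
      fix v :: "nat \<Rightarrow> real" assume v: "\<exists>i<n. v i \<noteq> 0"
      have "vec n v \<noteq> 0\<^sub>v n" using v by (auto simp: vec_eq_iff)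
      with A have "scalar_prod (vec n v) (K *\<^sub>v vec n v) > 0" by auto
      then show "(\<Sum>i<n. \<Sum>j<n. v i * K $$ (i, j) * v j) > 0"
        using scalar_prod_mat_vec[OF K, of "vec n v" "vec n v"] by simp
    qed
  next
    assume B: ?B
    show ?A
    proof (intro ballI impI)
      fix v :: "real Matrix.vec" assume v: "v \<in> carrier_vec n" "v \<noteq> 0\<^sub>v n"
      have "\<exists>i<n. v $ i \<noteq> 0" using v by (auto simp: vec_eq_iff)
      then show "scalar_prod v (K *\<^sub>v v) > 0"
        using B[rule_format, of "\<lambda>i. v $ i"] scalar_prod_mat_vec[OF K v(1) v(1)] by simp
    qed
  qed
  with sym K show ?thesis unfolding pos_def_def by blast
qed (simp add: pos_def_def)

lemma pos_def_det_nonzero: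
  assumes "pos_def n K" shows "Determinant.det K \<noteq> 0"
proof
  have K: "K \<in> carrier_mat n n" using assms by (simp add: pos_def_def)
  assume "Determinant.det K = 0"
  then obtain v where "v \<in> carrier_vec n" "v \<noteq> 0\<^sub>v n" "K *\<^sub>v v = 0\<^sub>v n"
    using det_0_iff_vec_prod_zero_field[OF K] by blast
  then show False using assms unfolding pos_def_def by fastforce
qed

lemma continuous_on_det:
  fixes g :: "'a::topological_space \<Rightarrow> nat \<times> nat \<Rightarrow> real"
  assumes "\<And>i j. i < n \<Longrightarrow> j < n \<Longrightarrow> continuous_on S (\<lambda>t. g t (i, j))"
  shows "continuous_on S (\<lambda>t. Determinant.det (Matrix.mat n n (g t)))"
proof -
  have "Determinant.det (Matrix.mat n n (g t)) =
     (\<Sum>p | p permutes {0..<n}. signof p * (\<Prod>i = 0..<n. g t (i, p i)))" for t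
    by (subst det_def'[of _ n])
       (auto intro!: sum.cong prod.cong simp: permutes_in_image[of _ "{0..<n}", simplified])
  then show ?thesis
    by (auto intro!: continuous_intros assms simp: permutes_in_image[of _ "{0..<n}", simplified])
qed

text \<open>The segment from the identity to \<open>K\<close> stays positive definite, so the
  determinant has no zero on it. It starts at 1, and the intermediate value theorem excludes a
  nonpositive value at the other end.\<close>

lemma pos_def_det_pos:
  assumes pd: "pos_def n K" shows "Determinant.det K > 0"
proof (rule ccontr)
  assume neg: "\<not> ?thesis"
  have K: "K \<in> carrier_mat n n" using pd by (simp add: pos_def_def)
  define g where "g t = (\<lambda>(i, j). t * K $$ (i, j) + (1 - t) * of_bool (i = j))" for t :: real
  define M where "M t = Matrix.mat n n (g t)" for t
  have "continuous_on {0..1} (\<lambda>t. Determinant.det (M t))"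
    unfolding M_def by (intro continuous_on_det) (auto simp: g_def intro!: continuous_intros)
  moreover have "M 1 = K" using K by (auto simp: M_def g_def mat_eq_iff)
  moreover have "M 0 = 1\<^sub>m n" by (auto simp: M_def g_def mat_eq_iff)
  ultimately have "\<exists>t. 0 \<le> t \<and> t \<le> 1 \<and> Determinant.det (M t) = 0"
    using neg by (intro IVT2') auto
  then obtain t where t: "0 \<le> t" "t \<le> 1" "Determinant.det (M t) = 0" by blast
  have "pos_def n (M t)"
    unfolding pos_def_iff
  proof (intro conjI allI impI)
    show "M t \<in> carrier_mat n n" by (simp add: M_def)
    show "M t $$ (i, j) = M t $$ (j, i)" if "i < n" "j < n" for i j
      using that pd by (auto simp: M_def g_def pos_def_iff)
    fix v :: "nat \<Rightarrow> real" assume v: "\<exists>i<n. v i \<noteq> 0"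
    have "(\<Sum>i<n. \<Sum>j<n. v i * M t $$ (i, j) * v j) =
       (\<Sum>i<n. \<Sum>j<n. t * (v i * K $$ (i, j) * v j) + (if i = j then (1 - t) * (v i * v i) else 0))"
      by (intro sum.cong) (auto simp: M_def g_def algebra_simps)
    also have "\<dots> = t * (\<Sum>i<n. \<Sum>j<n. v i * K $$ (i, j) * v j) + (1 - t) * (\<Sum>i<n. v i * v i)"
      by (simp add: sum.distrib sum_distrib_left sum.delta)
    also have "\<dots> > 0"
    proof -
      have 1: "(\<Sum>i<n. \<Sum>j<n. v i * K $$ (i, j) * v j) > 0" using pd v by (simp add: pos_def_iff)
      have 2: "(\<Sum>i<n. v i * v i) > 0"
      proof -
        obtain i where i: "i < n" "v i \<noteq> 0" using v by blast
        then have "0 < v i * v i" by (simp add: zero_less_mult_iff) linarith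
        then show ?thesis using i by (intro sum_pos2[of _ i]) auto
      qed
      show ?thesis
      proof (cases "t = 0")
        case False
        then have "0 < t * (\<Sum>i<n. \<Sum>j<n. v i * K $$ (i, j) * v j)" using 1 t by simp
        moreover have "0 \<le> (1 - t) * (\<Sum>i<n. v i * v i)" using 2 t by simp
        ultimately show ?thesis by linarith
      qed (use 2 in simp)
    qed
    finally show "(\<Sum>i<n. \<Sum>j<n. v i * M t $$ (i, j) * v j) > 0" .
  qed
  with t(3) show False using pos_def_det_nonzero by blast
qed

text \<open>The matrix determinant lemma. The bordered matrix \<open>P\<close> is brought to block
  triangular form in two ways, by \<open>R\<close> on the right and by the inverse of
  \<open>L\<close> on the left; both factors have determinant 1, and comparing the diagonal blocks
  gives the identity.\<close>

lemma det_rank_one_update: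
  fixes K :: "real mat"
  assumes K: "K \<in> carrier_mat n n" and B: "B \<in> carrier_mat n n" "B * K = 1\<^sub>m n"
    and u: "u \<in> carrier_vec n"
  shows "Determinant.det (K + Matrix.mat n n (\<lambda>(i, j). u $ i * u $ j)) =
    Determinant.det K * (1 + scalar_prod u (B *\<^sub>v u))"
proof -
  define U where "U = Matrix.mat n 1 (\<lambda>(i, j). u $ i)"
  define V where "V = Matrix.mat 1 n (\<lambda>(i, j). u $ j)"
  have U: "U \<in> carrier_mat n 1" and V: "V \<in> carrier_mat 1 n" by (simp_all add: U_def V_def)
  have UV: "U * V = Matrix.mat n n (\<lambda>(i, j). u $ i * u $ j)"
    by (rule eq_matI) (auto simp: U_def V_def scalar_prod_def)
  define P where "P = four_block_mat K (- U) V (1\<^sub>m 1)"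
  define R where "R = four_block_mat (1\<^sub>m n) (0\<^sub>m n 1) (- V) (1\<^sub>m 1)"
  define L where "L = four_block_mat (1\<^sub>m n) (0\<^sub>m n 1) (V * B) (1\<^sub>m 1)"
  define Q where "Q = four_block_mat K (- U) (0\<^sub>m 1 n) (1\<^sub>m 1 + V * B * U)"
  have VB: "V * B \<in> carrier_mat 1 n" using V B by simp
  have VBU: "V * B * U \<in> carrier_mat 1 1" using VB U by simp
  have carr: "P \<in> carrier_mat (n + 1) (n + 1)" "R \<in> carrier_mat (n + 1) (n + 1)"
    "L \<in> carrier_mat (n + 1) (n + 1)" "Q \<in> carrier_mat (n + 1) (n + 1)"
    unfolding P_def R_def L_def Q_def using K U V VB VBU by (auto intro!: four_block_carrier_mat)
  have PR: "P * R = four_block_mat (K + U * V) (- U) (0\<^sub>m 1 n) (1\<^sub>m 1)"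
    unfolding P_def R_def
  proof (subst mult_four_block_mat[of _ n n _ 1 _ 1 _ _ n _ 1])
    have "- U * - V = U * V" using U V by simp
    then show "four_block_mat (K * 1\<^sub>m n + - U * - V) (K * 0\<^sub>m n 1 + - U * 1\<^sub>m 1)
       (V * 1\<^sub>m n + 1\<^sub>m 1 * - V) (V * 0\<^sub>m n 1 + 1\<^sub>m 1 * 1\<^sub>m 1)
      = four_block_mat (K + U * V) (- U) (0\<^sub>m 1 n) (1\<^sub>m 1)"
      using K U V by (simp add: minus_add_uminus_mat[symmetric])
  qed (use K U V in auto)
  have LQ: "L * Q = P"
    unfolding L_def Q_def P_def
  proof (subst mult_four_block_mat[of _ n n _ 1 _ 1 _ _ n _ 1])
    have 1: "V * B * K = V" using assoc_mult_mat[OF V B(1) K] B V by simp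
    have 2: "V * B * - U = - (V * B * U)" using V B U by simp
    have "- Z + (1\<^sub>m 1 + Z) = 1\<^sub>m 1" if "Z \<in> carrier_mat 1 1" for Z :: "real mat"
      using that by (intro eq_matI) auto
    from this[OF VBU] have "- (V * B * U) + (1\<^sub>m 1 + V * B * U) = 1\<^sub>m 1" .
    then show "four_block_mat (1\<^sub>m n * K + 0\<^sub>m n 1 * 0\<^sub>m 1 n) (1\<^sub>m n * - U + 0\<^sub>m n 1 * (1\<^sub>m 1 + V * B * U))
       (V * B * K + 1\<^sub>m 1 * 0\<^sub>m 1 n) (V * B * - U + 1\<^sub>m 1 * (1\<^sub>m 1 + V * B * U))
      = four_block_mat K (- U) V (1\<^sub>m 1)"
      unfolding 1 2 using K U V VBU by simp
  qed (use K U V VB VBU in auto)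
  have "Determinant.det (P * R) = Determinant.det (K + U * V)"
    unfolding PR using K U V by (subst det_four_block_mat_lower_left_zero[of _ n _ 1]) auto
  moreover have "Determinant.det R = 1"
    unfolding R_def using V by (subst det_four_block_mat_upper_right_zero[of _ n _ 1]) auto
  moreover have "Determinant.det L = 1"
    unfolding L_def using VB by (subst det_four_block_mat_upper_right_zero[of _ n _ 1]) auto
  moreover have "Determinant.det Q = Determinant.det K * Determinant.det (1\<^sub>m 1 + V * B * U)"
    unfolding Q_def using K U VBU by (subst det_four_block_mat_lower_left_zero[of _ n _ 1]) auto
  moreover have "Determinant.det (1\<^sub>m 1 + V * B * U) = 1 + scalar_prod u (B *\<^sub>v u)"
  proof -
    have "(V * B * U) $$ (0, 0) = (V * (B * U)) $$ (0, 0)"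
      using assoc_mult_mat[OF V B(1) U] by simp
    also have "\<dots> = scalar_prod (Matrix.row V 0) (Matrix.col (B * U) 0)"
      using V B U by simp
    also have "Matrix.row V 0 = u" using u by (intro eq_vecI) (auto simp: V_def)
    also have "Matrix.col (B * U) 0 = B *\<^sub>v Matrix.col U 0"
      using B U by (intro eq_vecI) auto
    also have "Matrix.col U 0 = u" using u by (intro eq_vecI) (auto simp: U_def)
    finally have "(V * B * U) $$ (0, 0) = scalar_prod u (B *\<^sub>v u)" .
    moreover have "Determinant.det (1\<^sub>m 1 + Z) = 1 + Z $$ (0, 0)" if "Z \<in> carrier_mat 1 1" for Z :: "real mat"
      using that by (subst det_single) auto
    ultimately show ?thesis using VBU by metis
  qed
  ultimately show ?thesis
    using Determinant.det_mult[OF carr(1,2)] Determinant.det_mult[OF carr(3,4)] unfolding LQ UV by simp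
qed

text \<open>The relative gain of the determinant is u^T K^(-1) u. With z = K^(-1) u it equals z^T K
  z, which is positive as soon as u is nonzero.\<close>

lemma pos_def_rank_one_update:
  fixes u :: "nat \<Rightarrow> real"
  assumes pd: "pos_def n K"
  defines "K' \<equiv> Matrix.mat n n (\<lambda>(i, j). K $$ (i, j) + u i * u j)"
  shows "pos_def n K'" "\<exists>i<n. u i \<noteq> 0 \<Longrightarrow> Determinant.det K < Determinant.det K'"
proof -
  have K: "K \<in> carrier_mat n n" using pd by (simp add: pos_def_def)
  show "pos_def n K'"
    unfolding pos_def_iff
  proof (intro conjI allI impI)
    show "K' \<in> carrier_mat n n" by (simp add: K'_def)
    show "K' $$ (i, j) = K' $$ (j, i)" if "i < n" "j < n" for i j
      using that pd by (auto simp: K'_def pos_def_iff)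
    fix v :: "nat \<Rightarrow> real" assume v: "\<exists>i<n. v i \<noteq> 0"
    have "(\<Sum>i<n. \<Sum>j<n. v i * K' $$ (i, j) * v j) =
      (\<Sum>i<n. \<Sum>j<n. v i * K $$ (i, j) * v j + (v i * u i) * (v j * u j))"
      by (intro sum.cong refl) (simp add: K'_def algebra_simps)
    also have "\<dots> = (\<Sum>i<n. \<Sum>j<n. v i * K $$ (i, j) * v j) + (\<Sum>i<n. v i * u i)\<^sup>2"
      by (simp add: sum.distrib power2_eq_square sum_product)
    also have "\<dots> > 0" using pd v by (intro add_pos_nonneg) (auto simp: pos_def_iff)
    finally show "(\<Sum>i<n. \<Sum>j<n. v i * K' $$ (i, j) * v j) > 0" .
  qed
  assume ne: "\<exists>i<n. u i \<noteq> 0"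
  define w where "w = vec n u"
  have w: "w \<in> carrier_vec n" "w \<noteq> 0\<^sub>v n" using ne by (auto simp: w_def vec_eq_iff)
  obtain B where B: "B \<in> carrier_mat n n" "K * B = 1\<^sub>m n" "B * K = 1\<^sub>m n"
    using det_nonzero_inverse[OF K pos_def_det_nonzero[OF pd]] .
  define z where "z = B *\<^sub>v w"
  have z: "z \<in> carrier_vec n" using B w by (simp add: z_def)
  have Kz: "K *\<^sub>v z = w"
    unfolding z_def using assoc_mult_mat_vec[OF K B(1) w(1)] B w by simp
  have "z \<noteq> 0\<^sub>v n"
  proof
    assume "z = 0\<^sub>v n"
    then have "w = 0\<^sub>v n" using Kz K by auto
    with w(2) show False ..
  qed
  then have "0 < scalar_prod z (K *\<^sub>v z)" using pd z by (simp add: pos_def_def)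
  also have "scalar_prod z (K *\<^sub>v z) = scalar_prod w (B *\<^sub>v w)"
    unfolding Kz using comm_scalar_prod[OF z w(1)] by (simp add: z_def)
  finally have "0 < scalar_prod w (B *\<^sub>v w)" .
  moreover have "K' = K + Matrix.mat n n (\<lambda>(i, j). w $ i * w $ j)"
    using K by (intro eq_matI) (auto simp: K'_def w_def)
  ultimately show "Determinant.det K < Determinant.det K'"
    using det_rank_one_update[OF K B(1,3) w(1)] pos_def_det_pos[OF pd] by simp
qed

text \<open>Symmetric Gaussian elimination on \<open>A\<close>, one index of the support at a time:
  a zero pivot has a zero row, and a positive pivot splits off a rank one term, which strictly
  increases the determinant. The rest is a Schur complement with smaller support. The support
  \<open>I\<close> is separate from \<open>n\<close> for the sake of this induction.\<close>

lemma pos_def_add_psd: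
  fixes A :: "nat \<Rightarrow> nat \<Rightarrow> real"
  assumes "finite I" "I \<subseteq> {..<n}" "pos_def n K"
    and "\<And>i j. A i j = A j i"
    and "\<And>i j. A i j \<noteq> 0 \<Longrightarrow> i \<in> I \<and> j \<in> I"
    and "\<And>v. 0 \<le> (\<Sum>i\<in>I. \<Sum>j\<in>I. v i * A i j * v j)"
  defines "K' \<equiv> Matrix.mat n n (\<lambda>(i, j). K $$ (i, j) + A i j)"
  shows "pos_def n K' \<and> ((\<exists>i j. A i j \<noteq> 0) \<longrightarrow> Determinant.det K < Determinant.det K')"
  using assms(1-6) unfolding K'_def
proof (induction I arbitrary: K A rule: finite_induct)
  case empty
  have "A i j = 0" for i j using empty.prems by blast
  moreover have "Matrix.mat n n (\<lambda>(i, j). K $$ (i, j)) = K"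
    using empty.prems by (intro eq_matI) (auto simp: pos_def_def)
  ultimately show ?case using empty.prems by simp
next
  case (insert i I)
  have sym: "A j k = A k j" for j k by (rule insert.prems)
  have psd: "0 \<le> (\<Sum>j\<in>insert i I. \<Sum>k\<in>insert i I. v j * A j k * v k)" for v by (rule insert.prems)
  have fin: "finite (insert i I)" and iI: "i \<in> insert i I" "insert i I - {i} = I" "i < n"
    using insert.hyps insert.prems by auto
  show ?case
  proof (cases "A i i = 0")
    case True
    have row: "A i j = 0" for j
      using psd_on_diagonal(2)[where A = A, OF fin iI(1) sym psd True, of j] insert.prems(4)[of i j] by blast
    have "0 \<le> (\<Sum>j\<in>I. \<Sum>k\<in>I. v j * A j k * v k)" for v
    proof -
      have "A j i = 0" for j using row sym by metis
      then show ?thesis using psd[of v] insert.hyps row by simp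
    qed
    moreover have "j \<in> I \<and> k \<in> I" if "A j k \<noteq> 0" for j k
      using insert.prems(4)[OF that] row that sym by (metis insertE)
    ultimately show ?thesis
      using insert.IH[of K A] insert.prems(1,2) sym by auto
  next
    case False
    then have pos: "A i i > 0"
      using psd_on_diagonal(1)[where A = A, OF fin iI(1) sym psd] by linarith
    \<comment> \<open>The product \<open>u k * u l\<close> agrees with \<open>A\<close> on row and
      column \<open>i\<close>; subtracting it clears both and leaves the Schur complement
      \<open>A'\<close>.\<close>
    define u where "u k = A i k / sqrt (A i i)" for k
    define A' where "A' k l = A k l - A i k * A i l / A i i" for k l
    define K1 where "K1 = Matrix.mat n n (\<lambda>(k, l). K $$ (k, l) + u k * u l)"
    have uu: "u k * u l = A i k * A i l / A i i" for k l
      using pos by (simp add: u_def)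
    have "u i \<noteq> 0" using pos by (simp add: u_def)
    then have K1: "pos_def n K1" "Determinant.det K < Determinant.det K1"
      using pos_def_rank_one_update[OF insert.prems(2), of u] iI(3) unfolding K1_def by blast+
    have supp: "k \<in> I \<and> l \<in> I" if "A' k l \<noteq> 0" for k l
    proof -
      have "k \<noteq> i" using that pos by (auto simp: A'_def)
      moreover have "l \<noteq> i" using that pos by (auto simp: A'_def sym[of k i])
      moreover have "k \<in> insert i I" "l \<in> insert i I"
        using that insert.prems(4)[of k l] insert.prems(4)[of i k] insert.prems(4)[of i l]
        unfolding A'_def by fastforce+
      ultimately show ?thesis by blast
    qed
    have "0 \<le> (\<Sum>k\<in>I. \<Sum>l\<in>I. v k * A' k l * v l)" for v
      using psd_on_pivot[where A = A, OF fin iI(1) sym psd pos, of v] unfolding iI(2) A'_def .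
    then have IH: "pos_def n (Matrix.mat n n (\<lambda>(k, l). K1 $$ (k, l) + A' k l)) \<and>
        ((\<exists>k l. A' k l \<noteq> 0) \<longrightarrow> Determinant.det K1 < Determinant.det (Matrix.mat n n (\<lambda>(k, l). K1 $$ (k, l) + A' k l)))"
      using insert.prems(1) K1(1) supp by (intro insert.IH) (auto simp: A'_def sym mult.commute)
    have eq: "Matrix.mat n n (\<lambda>(k, l). K1 $$ (k, l) + A' k l) = Matrix.mat n n (\<lambda>(k, l). K $$ (k, l) + A k l)"
      by (intro eq_matI) (auto simp: K1_def A'_def uu)
    have "Determinant.det K1 \<le> Determinant.det (Matrix.mat n n (\<lambda>(k, l). K1 $$ (k, l) + A' k l))"
    proof (cases "\<exists>k l. A' k l \<noteq> 0")
      case False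
      then have "Matrix.mat n n (\<lambda>(k, l). K1 $$ (k, l) + A' k l) = K1"
        by (intro eq_matI) (auto simp: K1_def)
      then show ?thesis by simp
    qed (use IH in auto)
    then show ?thesis using IH K1(2) unfolding eq by linarith
  qed
qed

section \<open>Stresses as certificates against the MLE\<close>

lemma mat_trace_sample_cov:
  assumes "M \<in> carrier_mat n n"
  shows "mat_trace (sample_cov n N X * M) =
    (\<Sum>k<N. \<Sum>i<n. \<Sum>j<n. X k i * M $$ (i, j) * X k j) / real N"
proof -
  have "mat_trace (sample_cov n N X * M) =
     (\<Sum>i<n. \<Sum>j<n. (\<Sum>k<N. X k i * X k j) / real N * M $$ (j, i))"
    using assms by (auto simp: mat_trace_def sample_cov_def scalar_prod_def lessThan_atLeast0 intro!: sum.cong)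
  also have "\<dots> = (\<Sum>i<n. \<Sum>j<n. \<Sum>k<N. X k j * M $$ (j, i) * X k i) / real N"
    by (simp add: sum_divide_distrib sum_distrib_right sum_distrib_left mult_ac)
  also have "(\<Sum>i<n. \<Sum>j<n. \<Sum>k<N. X k j * M $$ (j, i) * X k i) =
      (\<Sum>i<n. \<Sum>k<N. \<Sum>j<n. X k j * M $$ (j, i) * X k i)"
    by (intro sum.cong refl sum.swap)
  also have "\<dots> = (\<Sum>k<N. \<Sum>i<n. \<Sum>j<n. X k j * M $$ (j, i) * X k i)" by (rule sum.swap)
  also have "\<dots> = (\<Sum>k<N. \<Sum>j<n. \<Sum>i<n. X k j * M $$ (j, i) * X k i)"
    by (intro sum.cong refl sum.swap)
  finally show ?thesis .
qed

lemma stress_not_mle_exists: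
  fixes A :: "nat \<Rightarrow> nat \<Rightarrow> real"
  assumes sym: "\<And>i j. A i j = A j i"
    and supp: "\<And>i j. A i j \<noteq> 0 \<Longrightarrow> i < n \<and> j < n \<and> (i = j \<or> {i, j} \<in> E)"
    and psd: "\<And>v. 0 \<le> (\<Sum>i<n. \<Sum>j<n. v i * A i j * v j)"
    and nz: "\<exists>i j. A i j \<noteq> 0"
    and stress: "\<And>i k. i < n \<Longrightarrow> k < N \<Longrightarrow> (\<Sum>j<n. A i j * X k j) = 0"
  shows "\<not> mle_exists n E N X"
proof
  assume "mle_exists n E N X"
  then obtain K where K: "K \<in> concentration_mats n E"
    and min: "\<And>K'. K' \<in> concentration_mats n E \<Longrightarrow>
      neg_log_lik (sample_cov n N X) K \<le> neg_log_lik (sample_cov n N X) K'"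
    unfolding mle_exists_def by blast
  have pd: "pos_def n K" using K by (simp add: concentration_mats_def)
  define K' where "K' = Matrix.mat n n (\<lambda>(i, j). K $$ (i, j) + A i j)"
  have K': "pos_def n K' \<and> ((\<exists>i j. A i j \<noteq> 0) \<longrightarrow> Determinant.det K < Determinant.det K')"
    unfolding K'_def by (rule pos_def_add_psd[where I = "{..<n}"]) (use pd sym supp psd in auto)
  have "K' \<in> concentration_mats n E"
    using K K' supp unfolding concentration_mats_def by (auto simp: K'_def)
  note min[OF this]
  moreover have "mat_trace (sample_cov n N X * K') = mat_trace (sample_cov n N X * K)"
  proof -
    have "(\<Sum>i<n. \<Sum>j<n. X k i * K' $$ (i, j) * X k j) = (\<Sum>i<n. \<Sum>j<n. X k i * K $$ (i, j) * X k j)"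
      if "k < N" for k
    proof -
      have "(\<Sum>i<n. \<Sum>j<n. X k i * K' $$ (i, j) * X k j) =
         (\<Sum>i<n. (\<Sum>j<n. X k i * K $$ (i, j) * X k j) + X k i * (\<Sum>j<n. A i j * X k j))"
        by (intro sum.cong refl) (simp add: K'_def sum_distrib_left sum.distrib[symmetric] algebra_simps)
      then show ?thesis using stress that by simp
    qed
    then show ?thesis using pd K' by (simp add: mat_trace_sample_cov pos_def_def)
  qed
  moreover have "ln (Determinant.det K) < ln (Determinant.det K')"
    using K' nz pos_def_det_pos[OF pd] by simp
  ultimately show False unfolding neg_log_lik_def by linarith
qed

section \<open>Existence of the MLE for invertible data\<close>

text \<open>A crude Leibniz bound. Only polynomial growth in \<open>t\<close> matters: the
  log-determinant then grows logarithmically and loses against the linear trace term.\<close>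

lemma abs_det_le:
  fixes K :: "real mat"
  assumes K: "K \<in> carrier_mat n n" and le: "\<And>i j. i < n \<Longrightarrow> j < n \<Longrightarrow> \<bar>K $$ (i, j)\<bar> \<le> t"
  shows "\<bar>Determinant.det K\<bar> \<le> fact n * t ^ n"
proof -
  have "\<bar>Determinant.det K\<bar> \<le> (\<Sum>p | p permutes {0..<n}. t ^ n)"
    unfolding det_def'[OF K]
  proof (intro order_trans[OF sum_abs] sum_mono)
    fix p assume "p \<in> {p. p permutes {0..<n}}"
    then have p: "p i < n" if "i < n" for i
      using that permutes_in_image[of p "{0..<n}" i] by simp
    have "\<bar>signof p * (\<Prod>i = 0..<n. K $$ (i, p i))\<bar> = (\<Prod>i = 0..<n. \<bar>K $$ (i, p i)\<bar>)"
      by (simp add: abs_mult abs_prod sign_def)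
    also have "\<dots> \<le> (\<Prod>i = 0..<n. t)"
      using le p by (intro prod_mono) auto
    finally show "\<bar>signof p * (\<Prod>i = 0..<n. K $$ (i, p i))\<bar> \<le> t ^ n" by simp
  qed
  then show ?thesis using card_permutations[of "{0..<n}" n] by simp
qed

text \<open>Expand the sum and use 2 b(v, w) <= b(v, v) + b(w, w), which is nonnegativity of the
  form at v - w. It serves to bound the form at a linear combination of data points by its values at
  the points.\<close>

lemma quadratic_form_sum_le:
  fixes A :: "nat \<Rightarrow> nat \<Rightarrow> real"
  assumes sym: "\<And>i j. i < n \<Longrightarrow> j < n \<Longrightarrow> A i j = A j i"
    and psd: "\<And>v. 0 \<le> (\<Sum>i<n. \<Sum>j<n. v i * A i j * v j)"
  shows "(\<Sum>i<n. \<Sum>j<n. (\<Sum>k<m. a k i) * A i j * (\<Sum>k<m. a k j)) \<le>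
     real m * (\<Sum>k<m. \<Sum>i<n. \<Sum>j<n. a k i * A i j * a k j)"
proof -
  define b where "b v w = (\<Sum>i<n. \<Sum>j<n. v i * A i j * w j)" for v w
  have bsym: "b v w = b w v" for v w
    unfolding b_def by (subst sum.swap) (intro sum.cong refl, simp add: sym mult_ac)
  have "2 * b v w \<le> b v v + b w w" for v w
  proof -
    have "b (\<lambda>i. v i - w i) (\<lambda>i. v i - w i) = b v v - b v w - b w v + b w w"
      unfolding b_def sum_subtractf[symmetric] sum.distrib[symmetric]
      by (intro sum.cong refl) (simp add: algebra_simps)
    then show ?thesis using psd[of "\<lambda>i. v i - w i"] bsym[of v w] by (simp add: b_def)
  qed
  then have "(\<Sum>k<m. \<Sum>l<m. 2 * b (a k) (a l)) \<le> (\<Sum>k<m. \<Sum>l<m. b (a k) (a k) + b (a l) (a l))"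
    by (intro sum_mono)
  also have "\<dots> = 2 * (real m * (\<Sum>k<m. b (a k) (a k)))"
    by (simp add: sum.distrib sum_distrib_left[symmetric])
  finally have "(\<Sum>k<m. \<Sum>l<m. b (a k) (a l)) \<le> real m * (\<Sum>k<m. b (a k) (a k))"
    by (simp add: sum_distrib_left[symmetric])
  moreover have "(\<Sum>k<m. \<Sum>l<m. b (a k) (a l)) =
     (\<Sum>i<n. \<Sum>j<n. (\<Sum>k<m. a k i) * A i j * (\<Sum>k<m. a k j))"
  proof -
    have "(\<Sum>k<m. \<Sum>l<m. b (a k) (a l)) = (\<Sum>k<m. \<Sum>i<n. \<Sum>l<m. \<Sum>j<n. a k i * A i j * a l j)"
      unfolding b_def by (intro sum.cong refl sum.swap)
    also have "\<dots> = (\<Sum>i<n. \<Sum>k<m. \<Sum>l<m. \<Sum>j<n. a k i * A i j * a l j)" by (rule sum.swap)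
    also have "\<dots> = (\<Sum>i<n. \<Sum>k<m. \<Sum>j<n. \<Sum>l<m. a k i * A i j * a l j)"
      by (intro sum.cong refl sum.swap)
    also have "\<dots> = (\<Sum>i<n. \<Sum>j<n. \<Sum>k<m. \<Sum>l<m. a k i * A i j * a l j)"
      by (intro sum.cong refl sum.swap)
    also have "\<dots> = (\<Sum>i<n. \<Sum>j<n. (\<Sum>k<m. a k i) * A i j * (\<Sum>k<m. a k j))"
      by (intro sum.cong refl, subst sum_distrib_right, subst sum_product, rule refl)
    finally show ?thesis .
  qed
  ultimately show ?thesis by (simp add: b_def)
qed

lemma quadratic_form_unit:
  fixes A :: "nat \<Rightarrow> nat \<Rightarrow> real"
  assumes "k < n"
  shows "(\<Sum>i<n. \<Sum>j<n. of_bool (i = k) * A i j * of_bool (j = k)) = A k k"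
proof -
  have "(\<Sum>i<n. \<Sum>j<n. of_bool (i = k) * A i j * of_bool (j = k)) =
      (\<Sum>i<n. if i = k then (\<Sum>j<n. if j = k then A k k else 0) else 0)"
    by (intro sum.cong) (auto intro!: sum.cong)
  then show ?thesis using assms by (simp add: sum.delta)
qed

text \<open>Testing on e_k + e_l and e_k - e_l bounds 2 |A k l| by A k k + A l l, and each diagonal
  entry is at most the trace.\<close>

lemma psd_entry_le_trace:
  fixes A :: "nat \<Rightarrow> nat \<Rightarrow> real"
  assumes sym: "\<And>i j. i < n \<Longrightarrow> j < n \<Longrightarrow> A i j = A j i"
    and psd: "\<And>v. 0 \<le> (\<Sum>i<n. \<Sum>j<n. v i * A i j * v j)"
    and k: "k < n" "l < n"
  shows "\<bar>A k l\<bar> \<le> (\<Sum>i<n. A i i)"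
proof -
  have diag: "0 \<le> A i i" if "i < n" for i
    using psd[of "\<lambda>j. of_bool (j = i)"] quadratic_form_unit[OF that] by simp
  have le: "A i i \<le> (\<Sum>i<n. A i i)" if "i < n" for i
    using that diag by (intro member_le_sum) auto
  have two: "(\<Sum>i<n. \<Sum>j<n. (of_bool (i = k) + s * of_bool (i = l)) * A i j * (of_bool (j = k) + s * of_bool (j = l)))
    = A k k + 2 * s * A k l + s * s * A l l" for s
  proof -
    have row: "(\<Sum>j<n. c j * (of_bool (j = k) + s * of_bool (j = l))) = c k + s * c l" for c :: "nat \<Rightarrow> real"
    proof -
      have "(\<Sum>j<n. c j * (of_bool (j = k) + s * of_bool (j = l))) =
        (\<Sum>j<n. (if j = k then c k else 0) + (if j = l then s * c l else 0))"
        by (intro sum.cong) (auto simp: algebra_simps)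
      then show ?thesis using k by (simp add: sum.distrib sum.delta)
    qed
    have "(\<Sum>i<n. \<Sum>j<n. (of_bool (i = k) + s * of_bool (i = l)) * A i j * (of_bool (j = k) + s * of_bool (j = l)))
      = (\<Sum>i<n. (A i k + s * A i l) * (of_bool (i = k) + s * of_bool (i = l)))"
      by (intro sum.cong refl, subst row) (simp add: algebra_simps)
    also note row
    finally show ?thesis using sym[OF k] by (simp add: algebra_simps)
  qed
  have "0 \<le> A k k + 2 * 1 * A k l + 1 * 1 * A l l" "0 \<le> A k k + 2 * (-1) * A k l + (-1) * (-1) * A l l"
    unfolding two[symmetric] by (rule psd)+
  then show ?thesis using le[OF k(1)] le[OF k(2)] by linarith
qed

text \<open>A null vector of a semidefinite form is orthogonal to everything under the form, hence
  lies in the kernel of the matrix. This makes a minimiser over a closed set, where only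
  semidefiniteness is available, positive definite.\<close>

lemma pos_def_if_psd_det:
  assumes K: "K \<in> carrier_mat n n" and sym: "\<And>i j. i < n \<Longrightarrow> j < n \<Longrightarrow> K $$ (i, j) = K $$ (j, i)"
    and psd: "\<And>v. 0 \<le> (\<Sum>i<n. \<Sum>j<n. v i * K $$ (i, j) * v j)"
    and det: "Determinant.det K \<noteq> 0"
  shows "pos_def n K"
  unfolding pos_def_iff
proof (intro conjI allI impI K sym)
  fix v :: "nat \<Rightarrow> real" assume v: "\<exists>i<n. v i \<noteq> 0"
  define b where "b v w = (\<Sum>i<n. \<Sum>j<n. v i * K $$ (i, j) * w j)" for v w
  have bsym: "b v w = b w v" for v w
    unfolding b_def by (subst sum.swap) (intro sum.cong refl, simp add: sym mult_ac)
  have "b v v \<noteq> 0"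
  proof
    assume 0: "b v v = 0"
    have zero: "b w v = 0" for w
    proof (rule ccontr)
      assume ne: "b w v \<noteq> 0"
      have "0 \<le> b w w + 2 * t * b w v" for t
      proof -
        have "b (\<lambda>i. w i + t * v i) (\<lambda>i. w i + t * v i) = b w w + t * b w v + t * b v w + t * t * b v v"
          unfolding b_def sum_distrib_left sum.distrib[symmetric]
          by (intro sum.cong refl) (simp add: algebra_simps)
        then show ?thesis using psd[of "\<lambda>i. w i + t * v i"] 0 bsym[of v w] by (simp add: b_def)
      qed
      from this[of "- (b w w + 1) / (2 * b w v)"] ne show False by (simp add: field_simps)
    qed
    have "K *\<^sub>v vec n v = 0\<^sub>v n"
    proof (intro eq_vecI)
      fix i assume i: "i < dim_vec (0\<^sub>v n :: real Matrix.vec)"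
      have "b (\<lambda>j. of_bool (j = i)) v = (\<Sum>k<n. if k = i then (\<Sum>j<n. K $$ (i, j) * v j) else 0)"
        unfolding b_def by (intro sum.cong) (auto intro!: sum.cong)
      also have "\<dots> = (K *\<^sub>v vec n v) $ i"
        using i K by (simp add: sum.delta scalar_prod_def lessThan_atLeast0)
      finally show "(K *\<^sub>v vec n v) $ i = 0\<^sub>v n $ i" using zero i by simp
    qed (use K in auto)
    moreover have "vec n v \<noteq> 0\<^sub>v n" using v by (auto simp: vec_eq_iff)
    moreover have "vec n v \<in> carrier_vec n" by simp
    ultimately show False using det det_0_iff_vec_prod_zero_field[OF K] by blast
  qed
  then show "(\<Sum>i<n. \<Sum>j<n. v i * K $$ (i, j) * v j) > 0"
    using psd[of v] by (simp add: b_def)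
qed

text \<open>Invertibility of the data matrix writes every unit vector as a combination of data
  points, so each diagonal entry of \<open>A\<close> is controlled by the form on the data. This is
  the coercivity of the trace term of the likelihood.\<close>

lemma trace_le_data_form:
  assumes det: "Determinant.det (Matrix.mat n n (\<lambda>(k, i). X k i)) \<noteq> (0::real)"
  shows "\<exists>c>0. \<forall>A. (\<forall>i<n. \<forall>j<n. A i j = A j i) \<longrightarrow> (\<forall>v. 0 \<le> (\<Sum>i<n. \<Sum>j<n. v i * A i j * v j)) \<longrightarrow>
     (\<Sum>i<n. A i i) \<le> c * (\<Sum>k<n. \<Sum>i<n. \<Sum>j<n. X k i * A i j * X k j)"
proof -
  define D where "D = Matrix.mat n n (\<lambda>(k, i). X k i)"
  have D: "D \<in> carrier_mat n n" by (simp add: D_def)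
  obtain B where B: "B \<in> carrier_mat n n" "D * B = 1\<^sub>m n" "B * D = 1\<^sub>m n"
    using det_nonzero_inverse[OF D] det by (auto simp: D_def)
  have unit: "(\<Sum>k<n. B $$ (i, k) * X k j) = of_bool (j = i)" if "i < n" "j < n" for i j
  proof -
    have "(B * D) $$ (i, j) = (\<Sum>k<n. B $$ (i, k) * X k j)"
      using that B(1) by (simp add: D_def scalar_prod_def lessThan_atLeast0)
    then show ?thesis using that unfolding B(3) by (auto simp: one_mat_def)
  qed
  obtain \<beta> where \<beta>: "\<beta> \<ge> 0" "\<And>s. s \<in> {..<n} \<times> {..<n} \<Longrightarrow> \<bar>(B $$ s)\<^sup>2\<bar> \<le> \<beta>"
    using finite_abs_bound[of "{..<n} \<times> {..<n}" "\<lambda>s. (B $$ s)\<^sup>2"] by blast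
  show ?thesis
  \<comment> \<open>The summand 1 only serves to make the constant strictly positive.\<close>
  proof (intro exI[of _ "real n * (real n * \<beta>) + 1"] conjI allI impI)
    fix A :: "nat \<Rightarrow> nat \<Rightarrow> real"
    assume sym': "\<forall>i<n. \<forall>j<n. A i j = A j i" and psd': "\<forall>v. 0 \<le> (\<Sum>i<n. \<Sum>j<n. v i * A i j * v j)"
    have sym: "A i j = A j i" if "i < n" "j < n" for i j using sym' that by blast
    have psd: "0 \<le> (\<Sum>i<n. \<Sum>j<n. v i * A i j * v j)" for v using psd' by blast
    define q where "q k = (\<Sum>i<n. \<Sum>j<n. X k i * A i j * X k j)" for k
    have q: "q k \<ge> 0" for k unfolding q_def by (rule psd)
    have "A l l \<le> real n * \<beta> * (\<Sum>k<n. q k)" if l: "l < n" for l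
    proof -
      have "A l l = (\<Sum>i<n. \<Sum>j<n. (\<Sum>k<n. B $$ (l, k) * X k i) * A i j * (\<Sum>k<n. B $$ (l, k) * X k j))"
        using unit[OF l] quadratic_form_unit[OF l, of A] by simp
      also have "\<dots> \<le> real n * (\<Sum>k<n. \<Sum>i<n. \<Sum>j<n. (B $$ (l, k) * X k i) * A i j * (B $$ (l, k) * X k j))"
        by (rule quadratic_form_sum_le[OF sym psd])
      also have "\<dots> = real n * (\<Sum>k<n. (B $$ (l, k))\<^sup>2 * q k)"
        by (simp add: q_def sum_distrib_left power2_eq_square mult_ac)
      also have "\<dots> \<le> real n * (\<Sum>k<n. \<beta> * q k)"
        using \<beta>(2) l q by (intro mult_left_mono sum_mono mult_right_mono) fastforce+
      finally show ?thesis by (simp add: sum_distrib_left[symmetric])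
    qed
    then have "(\<Sum>l<n. A l l) \<le> (\<Sum>l<n. real n * \<beta> * (\<Sum>k<n. q k))" by (intro sum_mono) auto
    also have "\<dots> \<le> (real n * (real n * \<beta>) + 1) * (\<Sum>k<n. q k)"
      using q by (simp add: distrib_right sum_nonneg)
    finally show "(\<Sum>l<n. A l l) \<le> (real n * (real n * \<beta>) + 1) * (\<Sum>k<n. \<Sum>i<n. \<Sum>j<n. X k i * A i j * X k j)"
      by (simp add: q_def)
  qed (use \<beta>(1) in \<open>simp add: add_nonneg_pos\<close>)
qed

text \<open>Tychonoff. Matrices are handled as functions on all index pairs, so compactness is taken
  in the product topology and closedness can be checked coordinatewise.\<close>

lemma compact_bounded_functions: "compact {g :: 'a \<Rightarrow> real. \<forall>p. \<bar>g p\<bar> \<le> T}"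
proof -
  have "compactin (product_topology (\<lambda>_::'a. euclidean :: real topology) UNIV) (PiE UNIV (\<lambda>_. {- T..T}))"
    unfolding compactin_PiE by simp
  moreover have "PiE UNIV (\<lambda>_::'a. {- T..T}) = {g. \<forall>p. \<bar>g p\<bar> \<le> T}"
    by (auto simp: PiE_def Pi_def abs_le_iff) (metis minus_le_iff)+
  ultimately show ?thesis by (simp add: euclidean_product_topology)
qed

text \<open>The part of the domain where the objective does not exceed its value \<open>f1\<close>
  at the identity lies in a compact set \<open>Q\<close> on which it is continuous. The minimiser
  over \<open>Q\<close> is then a minimiser over all concentration matrices.\<close>

lemma mle_exists_of_invertible_data:
  assumes n: "n > 0" and det: "Determinant.det (Matrix.mat n n (\<lambda>(k, i). X k i)) \<noteq> (0::real)"
  shows "mle_exists n E n X"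
proof -
  define f where "f K = neg_log_lik (sample_cov n n X) K" for K
  define q where "q K = (\<Sum>k<n. \<Sum>i<n. \<Sum>j<n. X k i * K (i, j) * X k j)" for K :: "nat \<times> nat \<Rightarrow> real"
  define M where "M g = Matrix.mat n n g" for g :: "nat \<times> nat \<Rightarrow> real"
  obtain c where "c > 0" and c': "\<forall>A. (\<forall>i<n. \<forall>j<n. A i j = A j i) \<longrightarrow>
      (\<forall>v. 0 \<le> (\<Sum>i<n. \<Sum>j<n. v i * A i j * v j)) \<longrightarrow>
      (\<Sum>i<n. A i i) \<le> c * (\<Sum>k<n. \<Sum>i<n. \<Sum>j<n. X k i * A i j * X k j)"
    using trace_le_data_form[OF det] by (elim exE conjE)
  have c: "(\<Sum>i<n. A i i) \<le> c * (\<Sum>k<n. \<Sum>i<n. \<Sum>j<n. X k i * A i j * X k j)"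
    if "\<And>i j. i < n \<Longrightarrow> j < n \<Longrightarrow> A i j = A j i" "\<And>v. 0 \<le> (\<Sum>i<n. \<Sum>j<n. v i * A i j * v j)" for A
    using c'[rule_format, of A] that by simp
  note cpos = \<open>c > 0\<close>
  have fM: "f (M g) = q g / real n - ln (Determinant.det (M g))" for g
    unfolding f_def neg_log_lik_def q_def M_def by (subst mat_trace_sample_cov[of _ n]) auto
  define f1 where "f1 = f (1\<^sub>m n)"
  \<comment> \<open>A bound for the trace of any competitor. With b = c n, the trace term is at
    least trace / b, while ln det <= ln n! + n ln trace, and the logarithm is absorbed into trace /
    (2 b); what remains, multiplied by 2 b, is \<open>T\<close>.\<close>
  define T where "T = 2 * (c * real n) * (f1 + ln (fact n) + real n * ln (2 * real n * (c * real n)))"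
  \<comment> \<open>Positive definiteness is an open condition; semidefiniteness together with a
    lower bound on the determinant is a closed replacement. The bound \<open>exp (- f1)\<close>
    holds on the sublevel set because the trace term is nonnegative. Entries outside the
    \<open>n\<close> by \<open>n\<close> range are later set to 0, hence
    \<open>max T 0\<close>.\<close>
  define Q where "Q = {g. (\<forall>p. \<bar>g p\<bar> \<le> max T 0) \<and> (\<forall>i\<in>{..<n}. \<forall>j\<in>{..<n}. g (i, j) = g (j, i)) \<and>
     (\<forall>p\<in>{(i, j). i < n \<and> j < n \<and> i \<noteq> j \<and> {i, j} \<notin> E}. g p = 0) \<and>
     (\<forall>v. 0 \<le> (\<Sum>i<n. \<Sum>j<n. v i * g (i, j) * v j)) \<and> exp (- f1) \<le> Determinant.det (M g)}"
  have coord: "continuous_on S (\<lambda>g. g p)" for S and p :: "nat \<times> nat"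
    by (rule continuous_on_subset[OF continuous_on_product_coordinates]) simp
  have detc: "continuous_on S (\<lambda>g. Determinant.det (M g))" for S
    unfolding M_def by (intro continuous_on_det coord)
  have "compact Q"
  proof -
    have Q_eq: "Q = {g. \<forall>p. \<bar>g p\<bar> \<le> max T 0} \<inter> ((\<Inter>i\<in>{..<n}. \<Inter>j\<in>{..<n}. {g. g (i, j) = g (j, i)}) \<inter>
       (\<Inter>p\<in>{(i, j). i < n \<and> j < n \<and> i \<noteq> j \<and> {i, j} \<notin> E}. {g. g p = 0}) \<inter>
       (\<Inter>v. {g. 0 \<le> (\<Sum>i<n. \<Sum>j<n. v i * g (i, j) * v j)}) \<inter> {g. exp (- f1) \<le> Determinant.det (M g)})"
      unfolding Q_def by auto
    have "closed ((\<Inter>i\<in>{..<n}. \<Inter>j\<in>{..<n}. {g. g (i, j) = g (j, i)}) \<inter>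
       (\<Inter>p\<in>{(i, j). i < n \<and> j < n \<and> i \<noteq> j \<and> {i, j} \<notin> E}. {g. g p = 0}) \<inter>
       (\<Inter>v. {g. 0 \<le> (\<Sum>i<n. \<Sum>j<n. v i * g (i, j) * v j)}) \<inter> {g. exp (- f1) \<le> Determinant.det (M g)})"
      by (intro closed_Int closed_INT ballI closed_Collect_eq closed_Collect_le continuous_intros coord detc)
    then show ?thesis
      unfolding Q_eq by (rule compact_Int_closed[OF compact_bounded_functions])
  qed
  have detQ: "Determinant.det (M g) > 0" if "g \<in> Q" for g
  proof -
    have "exp (- f1) \<le> Determinant.det (M g)" using that by (simp add: Q_def)
    then show ?thesis using less_le_trans[OF exp_gt_zero] by metis
  qed
  have "continuous_on Q (\<lambda>g. f (M g))"
    unfolding fM q_def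
    by (intro continuous_intros coord detc) (use n in simp, use detQ in fastforce)
  have inQ: "\<exists>g\<in>Q. M g = K" if K: "K \<in> concentration_mats n E" and le: "f K \<le> f1" for K
  proof -
    have pd: "pos_def n K" and pat: "\<And>i j. i < n \<Longrightarrow> j < n \<Longrightarrow> i \<noteq> j \<Longrightarrow> {i, j} \<notin> E \<Longrightarrow> K $$ (i, j) = 0"
      using K by (auto simp: concentration_mats_def)
    have sym: "K $$ (i, j) = K $$ (j, i)" if "i < n" "j < n" for i j
      using pd that unfolding pos_def_iff by blast
    have pos: "(\<Sum>i<n. \<Sum>j<n. v i * K $$ (i, j) * v j) > 0" if "\<exists>i<n. v i \<noteq> 0" for v
      using pd that unfolding pos_def_iff by blast
    have psd: "0 \<le> (\<Sum>i<n. \<Sum>j<n. v i * K $$ (i, j) * v j)" for v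
    proof (cases "\<exists>i<n. v i \<noteq> 0")
      case False then show ?thesis by simp
    qed (use pos[of v] in simp)
    define g where "g = (\<lambda>(i, j). if i < n \<and> j < n then K $$ (i, j) else 0)"
    have Mg: "M g = K" using pd by (intro eq_matI) (auto simp: M_def g_def pos_def_def)
    define \<tau> where "\<tau> = (\<Sum>i<n. K $$ (i, i))"
    have "K $$ (i, i) > 0" if "i < n" for i
      using pos[of "\<lambda>j. of_bool (j = i)"] quadratic_form_unit[OF that, of "\<lambda>i j. K $$ (i, j)"] that by auto
    then have \<tau>: "\<tau> > 0" unfolding \<tau>_def using n by (intro sum_pos) auto
    have entry: "\<bar>K $$ (i, j)\<bar> \<le> \<tau>" if "i < n" "j < n" for i j
      unfolding \<tau>_def by (rule psd_entry_le_trace[of n "\<lambda>i j. K $$ (i, j)", OF sym psd that])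
    have dpos: "Determinant.det K > 0" by (rule pos_def_det_pos[OF pd])
    have "Determinant.det K \<le> fact n * \<tau> ^ n"
      using abs_det_le[of K n \<tau>] pd entry by (auto simp: pos_def_def)
    then have "ln (Determinant.det K) \<le> ln (fact n * \<tau> ^ n)"
      using dpos by (subst ln_le_cancel_iff) (auto simp: \<tau>)
    also have "\<dots> = ln (fact n) + real n * ln \<tau>"
      using \<tau> by (simp add: ln_mult_pos ln_realpow)
    finally have lndet: "ln (Determinant.det K) \<le> ln (fact n) + real n * ln \<tau>" .
    have "q g = (\<Sum>k<n. \<Sum>i<n. \<Sum>j<n. X k i * K $$ (i, j) * X k j)"
      by (simp add: q_def g_def)
    then have \<tau>q: "\<tau> \<le> c * q g" and q0: "q g \<ge> 0"
      unfolding \<tau>_def using c[of "\<lambda>i j. K $$ (i, j)", OF sym psd] psd by (auto intro: sum_nonneg)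
    have fK: "q g / real n - ln (Determinant.det K) \<le> f1" using le fM[of g] Mg by simp
    define b where "b = c * real n"
    have b: "b > 0" using cpos n by (simp add: b_def)
    have "\<tau> / b \<le> q g / real n" using \<tau>q cpos n by (simp add: b_def field_simps)
    \<comment> \<open>This is ln y <= y - 1 at y = trace / (2 n b). The scale is chosen so that,
      after multiplication by \<open>n\<close>, the linear term is half of the available trace /
      b.\<close>
    moreover have "ln \<tau> \<le> \<tau> / (2 * real n * b) + ln (2 * real n * b)"
    proof -
      have p: "\<tau> / (2 * real n * b) > 0" "2 * real n * b > 0" using \<tau> b n by auto
      have "ln \<tau> = ln (\<tau> / (2 * real n * b) * (2 * real n * b))" using b n by simp
      also have "\<dots> = ln (\<tau> / (2 * real n * b)) + ln (2 * real n * b)" by (rule ln_mult_pos[OF p])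
      finally show ?thesis using ln_le_minus_one[OF p(1)] by linarith
    qed
    then have "real n * ln \<tau> \<le> real n * (\<tau> / (2 * real n * b) + ln (2 * real n * b))"
      by (intro mult_left_mono) auto
    moreover have "real n * (\<tau> / (2 * real n * b) + ln (2 * real n * b)) = \<tau> / (2 * b) + real n * ln (2 * real n * b)"
      using n by (simp add: distrib_left)
    moreover have "\<tau> / b = 2 * (\<tau> / (2 * b))" by simp
    ultimately have "\<tau> / (2 * b) \<le> f1 + ln (fact n) + real n * ln (2 * real n * b)"
      using fK lndet by linarith
    then have "\<tau> \<le> T" unfolding T_def b_def[symmetric] using b by (simp add: field_simps)
    then have bound: "\<bar>g p\<bar> \<le> max T 0" for p
      using entry[of "fst p" "snd p"] by (cases p) (auto simp: g_def)
    have "- f1 \<le> ln (Determinant.det K)"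
    proof -
      have "q g / real n \<ge> 0" using q0 by simp
      then show ?thesis using fK by linarith
    qed
    then have "exp (- f1) \<le> Determinant.det K" using dpos by (metis exp_le_cancel_iff exp_ln)
    moreover have "(\<Sum>i<n. \<Sum>j<n. v i * g (i, j) * v j) = (\<Sum>i<n. \<Sum>j<n. v i * K $$ (i, j) * v j)" for v
      by (intro sum.cong refl) (simp add: g_def)
    ultimately have "g \<in> Q"
      unfolding Q_def mem_Collect_eq Mg using bound sym pat psd
      by (intro conjI allI ballI) (auto simp: g_def)
    with Mg show ?thesis by blast
  qed
  have one: "1\<^sub>m n \<in> concentration_mats n E"
  proof -
    have "(\<Sum>i<n. \<Sum>j<n. v i * (1\<^sub>m n :: real mat) $$ (i, j) * v j) = (\<Sum>i<n. v i * v i)" for v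
    proof -
      have "(\<Sum>i<n. \<Sum>j<n. v i * (1\<^sub>m n :: real mat) $$ (i, j) * v j) = (\<Sum>i<n. \<Sum>j<n. if j = i then v i * v i else 0)"
        by (intro sum.cong refl) auto
      then show ?thesis by (simp add: sum.delta)
    qed
    moreover have "(\<Sum>i<n. v i * v i) > 0" if v: "\<exists>i<n. v i \<noteq> 0" for v :: "nat \<Rightarrow> real"
    proof -
      obtain i where "i < n" "v i \<noteq> 0" using v by blast
      moreover from this have "0 < v i * v i" by (simp add: zero_less_mult_iff) linarith
      ultimately show ?thesis by (intro sum_pos2[of _ i]) auto
    qed
    ultimately show ?thesis by (auto simp: concentration_mats_def pos_def_iff)
  qed
  have "Q \<noteq> {}" using inQ[OF one] by (auto simp: f1_def)
  then obtain g where g: "g \<in> Q" "\<And>g'. g' \<in> Q \<Longrightarrow> f (M g) \<le> f (M g')"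
    using continuous_attains_inf[OF \<open>compact Q\<close> _ \<open>continuous_on Q (\<lambda>g. f (M g))\<close>] by blast
  have "pos_def n (M g)"
  proof (rule pos_def_if_psd_det)
    show "M g $$ (i, j) = M g $$ (j, i)" if "i < n" "j < n" for i j
      using g(1) that by (simp add: Q_def M_def)
    show "0 \<le> (\<Sum>i<n. \<Sum>j<n. v i * M g $$ (i, j) * v j)" for v
      using g(1) by (simp add: Q_def M_def)
    show "Determinant.det (M g) \<noteq> 0" using detQ[OF g(1)] by simp
  qed (simp add: M_def)
  then have "M g \<in> concentration_mats n E"
    using g(1) by (auto simp: concentration_mats_def Q_def M_def)
  moreover have "f (M g) \<le> f K'" if "K' \<in> concentration_mats n E" for K'
  proof (cases "f K' \<le> f1")
    case True
    then show ?thesis using inQ[OF that] g(2) by blast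
  next
    case False
    then show ?thesis using inQ[OF one] g(2) unfolding f1_def by fastforce
  qed
  ultimately show ?thesis unfolding mle_exists_def f_def by blast
qed

section \<open>Almost sure statements about the data\<close>

text \<open>Fubini for the indicator of the failure set. It is used on two levels: for one
  coordinate of a sample, and for one sample among several.\<close>

lemma (in product_sigma_finite) AE_PiM_insert:
  assumes I: "finite I" "i \<notin> I"
    and P: "Measurable.pred (Pi\<^sub>M (insert i I) M) P"
    and ae: "AE x in Pi\<^sub>M I M. AE y in M i. P (x(i := y))"
  shows "AE x in Pi\<^sub>M (insert i I) M. P x"
proof -
  define f where "f x = (if P x then 0 else 1 :: ennreal)" for x
  have f: "f \<in> borel_measurable (Pi\<^sub>M (insert i I) M)"
    unfolding f_def using P by measurable
  have "(\<integral>\<^sup>+ x. f x \<partial>Pi\<^sub>M (insert i I) M) = (\<integral>\<^sup>+ x. (\<integral>\<^sup>+ y. f (x(i := y)) \<partial>M i) \<partial>Pi\<^sub>M I M)"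
    by (rule product_nn_integral_insert[OF I f])
  also have "\<dots> = (\<integral>\<^sup>+ x. 0 \<partial>Pi\<^sub>M I M)"
  proof (rule nn_integral_cong_AE, use ae in eventually_elim)
    fix x assume "AE y in M i. P (x(i := y))"
    then have "AE y in M i. f (x(i := y)) = 0" by eventually_elim (simp add: f_def)
    then have "(\<integral>\<^sup>+ y. f (x(i := y)) \<partial>M i) = (\<integral>\<^sup>+ y. 0 \<partial>M i)" by (rule nn_integral_cong_AE)
    then show "(\<integral>\<^sup>+ y. f (x(i := y)) \<partial>M i) = 0" by simp
  qed
  finally have "AE x in Pi\<^sub>M (insert i I) M. f x = 0"
    using nn_integral_0_iff_AE[OF f] by simp
  then show ?thesis by eventually_elim (simp add: f_def split: if_splits)
qed

text \<open>With the other coordinates fixed, coordinate \<open>k\<close> has to avoid a single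
  value. The form involves only the coordinates up to \<open>k\<close>, as it will come from a
  leading minor.\<close>

lemma AE_lebesgue_n_hyperplane:
  fixes a :: "nat \<Rightarrow> real"
  assumes k: "k < n" "a k \<noteq> 0"
  shows "AE y in lebesgue_n n. (\<Sum>j<Suc k. y j * a j) \<noteq> 0"
proof -
  interpret product_sigma_finite "\<lambda>_::nat. lborel :: real measure"
    by standard
  have ins: "{..<n} = insert k ({..<n} - {k})" using k by auto
  have "AE y in Pi\<^sub>M (insert k ({..<n} - {k})) (\<lambda>_. lborel). (\<Sum>j<Suc k. y j * a j) \<noteq> 0"
  proof (rule AE_PiM_insert)
    have "(\<lambda>y. \<Sum>j<Suc k. y j * a j) \<in> borel_measurable (Pi\<^sub>M (insert k ({..<n} - {k})) (\<lambda>_. lborel))"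
    proof (intro borel_measurable_sum borel_measurable_times borel_measurable_const)
      fix j assume "j \<in> {..<Suc k}"
      then have "j \<in> insert k ({..<n} - {k})" using k by auto
      then have "(\<lambda>y. y j) \<in> measurable (Pi\<^sub>M (insert k ({..<n} - {k})) (\<lambda>_. lborel)) (lborel :: real measure)"
        by (rule measurable_component_singleton)
      then show "(\<lambda>y. y j) \<in> borel_measurable (Pi\<^sub>M (insert k ({..<n} - {k})) (\<lambda>_. lborel :: real measure))"
        by simp
    qed
    then show "Measurable.pred (Pi\<^sub>M (insert k ({..<n} - {k})) (\<lambda>_. lborel)) (\<lambda>y. (\<Sum>j<Suc k. y j * a j) \<noteq> 0)"
      by measurable
    show "AE x in Pi\<^sub>M ({..<n} - {k}) (\<lambda>_. lborel). AE y in lborel. (\<Sum>j<Suc k. (x(k := y)) j * a j) \<noteq> 0"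
    proof (rule AE_I2)
      fix x :: "nat \<Rightarrow> real"
      have "AE y in lborel. y \<noteq> - (\<Sum>j<k. x j * a j) / a k" by (rule AE_lborel_singleton)
      then show "AE y in lborel. (\<Sum>j<Suc k. (x(k := y)) j * a j) \<noteq> 0"
        by eventually_elim (use k in \<open>simp add: field_simps\<close>)
    qed
  qed auto
  then show ?thesis unfolding ins[symmetric] .
qed

text \<open>Induction on the leading minors of the data matrix: sample \<open>k\<close> is
  independent of the earlier ones, and the next minor vanishes only if that sample lies on a
  hyperplane which they determine. The empty minor is 1.\<close>

lemma AE_data_det_nonzero:
  assumes ac: "ac_distribution n \<mu>" and "k \<le> n"
  shows "AE X in Pi\<^sub>M {..<k} (\<lambda>_. \<mu>). Determinant.det (Matrix.mat k k (\<lambda>(r, c). X r c)) \<noteq> (0::real)"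
  using assms(2)
proof (induction k)
  case 0
  show ?case by (intro AE_I2) simp
next
  case (Suc k)
  have \<mu>: "prob_space \<mu>" "sets \<mu> = sets (lebesgue_n n)" "absolutely_continuous (lebesgue_n n) \<mu>"
    using ac by (auto simp: ac_distribution_def)
  interpret product_sigma_finite "\<lambda>_::nat. \<mu>"
    using \<mu>(1) by (simp add: product_sigma_finite_def prob_space_imp_sigma_finite)
  have meas: "(\<lambda>X. X r c) \<in> borel_measurable (Pi\<^sub>M {..<l} (\<lambda>_. \<mu>))" if "r < l" "c < n" for r c l
  proof -
    have "(\<lambda>x. x c) \<in> borel_measurable (lebesgue_n n)"
      using measurable_component_singleton[of c "{..<n}" "\<lambda>_. lborel :: real measure"] that by simp
    then have "(\<lambda>x. x c) \<in> borel_measurable \<mu>"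
      by (simp only: measurable_cong_sets[OF \<mu>(2) refl])
    moreover have "(\<lambda>X. X r) \<in> measurable (Pi\<^sub>M {..<l} (\<lambda>_. \<mu>)) \<mu>"
      using that by (intro measurable_component_singleton) auto
    ultimately show ?thesis by (rule measurable_compose_rev)
  qed
  have ins: "{..<Suc k} = insert k {..<k}" by auto
  define A where "A X = Matrix.mat (Suc k) (Suc k) (\<lambda>(r, c). X r c :: real)" for X
  have detA: "Determinant.det (A X) = (\<Sum>p | p permutes {0..<Suc k}. signof p * (\<Prod>i = 0..<Suc k. X i (p i)))" for X
    unfolding A_def by (subst det_def'[of _ "Suc k"])
      (auto intro!: sum.cong prod.cong simp: permutes_in_image[of _ "{0..<Suc k}", simplified])
  have "AE X in Pi\<^sub>M (insert k {..<k}) (\<lambda>_. \<mu>). Determinant.det (A X) \<noteq> 0"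
  proof (rule AE_PiM_insert)
    have "(\<lambda>X. Determinant.det (A X)) \<in> borel_measurable (Pi\<^sub>M {..<Suc k} (\<lambda>_. \<mu>))"
      unfolding detA
    proof (intro borel_measurable_sum borel_measurable_times borel_measurable_const borel_measurable_prod meas)
      fix p i assume "p \<in> {p. p permutes {0..<Suc k}}" "i \<in> {0..<Suc k}"
      then have "p i < Suc k" using permutes_in_image[of p "{0..<Suc k}" i] by simp
      then show "p i < n" using Suc.prems by simp
    qed auto
    then show "Measurable.pred (Pi\<^sub>M (insert k {..<k}) (\<lambda>_. \<mu>)) (\<lambda>X. Determinant.det (A X) \<noteq> 0)"
      unfolding ins by measurable
    have "AE X in Pi\<^sub>M {..<k} (\<lambda>_. \<mu>). Determinant.det (Matrix.mat k k (\<lambda>(r, c). X r c)) \<noteq> (0::real)"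
      using Suc by simp
    then show "AE X in Pi\<^sub>M {..<k} (\<lambda>_. \<mu>). AE y in \<mu>. Determinant.det (A (X(k := y))) \<noteq> 0"
    proof eventually_elim
      fix X :: "nat \<Rightarrow> nat \<Rightarrow> real" assume nz: "Determinant.det (Matrix.mat k k (\<lambda>(r, c). X r c)) \<noteq> 0"
      \<comment> \<open>Expanding along the new row gives a linear form whose last coefficient is the previous minor.\<close>
      define a where "a j = cofactor (A X) k j" for j
      have "mat_delete (A X) k k = Matrix.mat k k (\<lambda>(r, c). X r c)"
        by (intro eq_matI) (auto simp: mat_delete_def A_def)
      then have "a k \<noteq> 0" using nz by (simp add: a_def cofactor_def)
      then have "AE y in lebesgue_n n. (\<Sum>j<Suc k. y j * a j) \<noteq> 0"
        using Suc.prems by (intro AE_lebesgue_n_hyperplane) auto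
      then have "AE y in \<mu>. (\<Sum>j<Suc k. y j * a j) \<noteq> 0"
        by (rule absolutely_continuous_AE[OF \<mu>(2) \<mu>(3)])
      moreover have "Determinant.det (A (X(k := y))) = (\<Sum>j<Suc k. y j * a j)" for y
      proof -
        have "mat_delete (A (X(k := y))) k j = mat_delete (A X) k j" for j
          by (intro eq_matI) (auto simp: mat_delete_def A_def)
        then have "cofactor (A (X(k := y))) k j = a j" for j by (simp add: a_def cofactor_def)
        moreover have "A (X(k := y)) $$ (k, j) = y j" if "j < Suc k" for j using that by (simp add: A_def)
        ultimately show ?thesis
          using laplace_expansion_row[of "A (X(k := y))" "Suc k" k] by (simp add: A_def)
      qed
      ultimately show "AE y in \<mu>. Determinant.det (A (X(k := y))) \<noteq> 0" by simp
    qed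
  qed auto
  then show ?case unfolding ins[symmetric] A_def .
qed

section \<open>Boxes of data with positive probability\<close>

definition gaussian_n :: "nat \<Rightarrow> (nat \<Rightarrow> real) measure" where
  "gaussian_n n = density (lebesgue_n n) (\<lambda>x. \<Prod>i<n. ennreal (std_normal_density (x i)))"

lemma ac_distribution_gaussian: "ac_distribution n (gaussian_n n)"
proof -
  interpret product_sigma_finite "\<lambda>_::nat. lborel :: real measure"
    by standard
  define f where "f x = (\<Prod>i<n. ennreal (std_normal_density (x i)))" for x :: "nat \<Rightarrow> real"
  have comp: "(\<lambda>x. x i) \<in> borel_measurable (lebesgue_n n)" if "i < n" for i
    using measurable_component_singleton[of i "{..<n}" "\<lambda>_. lborel :: real measure"] that by simp
  have f: "f \<in> borel_measurable (lebesgue_n n)"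
    unfolding f_def
  proof (intro borel_measurable_prod_ennreal)
    fix i assume "i \<in> {..<n}"
    then have [measurable]: "(\<lambda>x. x i) \<in> borel_measurable (lebesgue_n n)" using comp by simp
    show "(\<lambda>x. ennreal (std_normal_density (x i))) \<in> borel_measurable (lebesgue_n n)" by measurable
  qed
  have one: "(\<integral>\<^sup>+ x. ennreal (std_normal_density x) \<partial>lborel) = 1"
  proof -
    interpret G: prob_space "density lborel std_normal_density" by (rule prob_space_normal_density) simp
    show ?thesis using G.emeasure_space_1 by (simp add: emeasure_density)
  qed
  have "emeasure (density (lebesgue_n n) f) (space (density (lebesgue_n n) f)) = (\<integral>\<^sup>+ x. f x \<partial>lebesgue_n n)"
    by (simp add: emeasure_density[OF f sets.top] cong: nn_integral_cong)
  also have "\<dots> = (\<Prod>i<n. \<integral>\<^sup>+ x. ennreal (std_normal_density x) \<partial>lborel)"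
    unfolding f_def by (rule product_nn_integral_prod) auto
  finally have "prob_space (density (lebesgue_n n) f)"
    by (intro prob_spaceI) (simp add: one)
  moreover have "absolutely_continuous (density (lebesgue_n n) f) (lebesgue_n n)"
    unfolding absolutely_continuous_def
  proof
    fix A assume "A \<in> null_sets (density (lebesgue_n n) f)"
    then have A: "A \<in> sets (lebesgue_n n)" "AE x in lebesgue_n n. x \<in> A \<longrightarrow> f x = 0"
      using null_sets_density_iff[OF f] by auto
    have "f x \<noteq> 0" for x
      by (simp add: f_def prod_ennreal ennreal_eq_0_iff not_le prod_pos normal_density_pos)
    with A(2) have "AE x in lebesgue_n n. x \<notin> A" by simp
    then show "A \<in> null_sets (lebesgue_n n)" using AE_iff_null_sets[OF A(1)] by blast
  qed
  moreover have "absolutely_continuous (lebesgue_n n) (density (lebesgue_n n) f)"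
    by (rule absolutely_continuousI_density[OF f])
  ultimately show ?thesis by (simp add: ac_distribution_def gaussian_n_def f_def[abs_def])
qed

text \<open>\<open>mle_exists_as\<close> ranges over all admissible laws, so one of them suffices
  for a refutation. The Gaussian law gives the box positive probability. The argument is about the
  box, which is measurable, and never about the set of data that have an MLE.\<close>

lemma not_mle_exists_as_if_box:
  assumes \<delta>: "\<delta> > 0"
    and box: "\<And>X. (\<And>k i. k < N \<Longrightarrow> i < n \<Longrightarrow> \<bar>X k i - c k i\<bar> \<le> \<delta>) \<Longrightarrow> \<not> mle_exists n E N X"
  shows "\<not> mle_exists_as n E N"
proof
  assume as: "mle_exists_as n E N"
  define \<mu> where "\<mu> = gaussian_n n"
  have ac: "ac_distribution n \<mu>" unfolding \<mu>_def by (rule ac_distribution_gaussian)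
  have \<mu>: "prob_space \<mu>" "sets \<mu> = sets (lebesgue_n n)" "absolutely_continuous \<mu> (lebesgue_n n)"
    using ac by (auto simp: ac_distribution_def)
  interpret L: product_sigma_finite "\<lambda>_::nat. lborel :: real measure"
    by standard
  interpret P: product_sigma_finite "\<lambda>_::nat. \<mu>"
    using \<mu>(1) by (simp add: product_sigma_finite_def prob_space_imp_sigma_finite)
  define B where "B k = Pi\<^sub>E {..<n} (\<lambda>i. {c k i - \<delta>..c k i + \<delta>})" for k
  have Bs: "B k \<in> sets (lebesgue_n n)" for k
    unfolding B_def by (rule sets_PiM_I_finite) auto
  have "emeasure (lebesgue_n n) (B k) = (\<Prod>i<n. ennreal (2 * \<delta>))" for k
    unfolding B_def by (subst L.emeasure_PiM) (use \<delta> in auto)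
  then have "emeasure (lebesgue_n n) (B k) \<noteq> 0" for k
    using \<delta> by (simp add: ennreal_eq_0_iff)
  then have B0: "emeasure \<mu> (B k) \<noteq> 0" for k
    using \<mu>(3) Bs[of k] \<mu>(2) unfolding absolutely_continuous_def null_sets_def by fastforce
  define Bx where "Bx = Pi\<^sub>E {..<N} B"
  have Bxs: "Bx \<in> sets (Pi\<^sub>M {..<N} (\<lambda>_. \<mu>))"
    unfolding Bx_def using Bs \<mu>(2) by (intro sets_PiM_I_finite) auto
  have "emeasure (Pi\<^sub>M {..<N} (\<lambda>_. \<mu>)) Bx = (\<Prod>k<N. emeasure \<mu> (B k))"
    unfolding Bx_def using Bs \<mu>(2) by (intro P.emeasure_PiM) auto
  then have nz: "emeasure (Pi\<^sub>M {..<N} (\<lambda>_. \<mu>)) Bx \<noteq> 0" using B0 by simp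
  have "AE X in Pi\<^sub>M {..<N} (\<lambda>_. \<mu>). mle_exists n E N X"
    using as ac by (simp add: mle_exists_as_def)
  then have "AE X in Pi\<^sub>M {..<N} (\<lambda>_. \<mu>). X \<notin> Bx"
  proof eventually_elim
    fix X assume ex: "mle_exists n E N X"
    show "X \<notin> Bx"
    proof
      assume "X \<in> Bx"
      then have "\<bar>X k i - c k i\<bar> \<le> \<delta>" if "k < N" "i < n" for k i
      proof -
        have "X k i \<in> {c k i - \<delta>..c k i + \<delta>}"
          using \<open>X \<in> Bx\<close> that unfolding Bx_def B_def PiE_iff by blast
        then show ?thesis by (simp add: abs_le_iff)
      qed
      then show False using box ex by blast
    qed
  qed
  then show False using AE_iff_null_sets[OF Bxs] nz by auto
qed

section \<open>Stresses near a rigid partition\<close>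

text \<open>In the maximum norm \<open>A\<close> differs from the identity by at most 1/2, so v is
  bounded by twice A v. This estimate gives injectivity, hence solvability of the square system, and
  also the bound on the solution. It is applied to the correction of the stress and to the values at
  the roots.\<close>

lemma near_identity_solvable:
  fixes A :: "'a \<Rightarrow> 'a \<Rightarrow> real"
  assumes fin: "finite I"
    and near: "\<And>i j. i \<in> I \<Longrightarrow> j \<in> I \<Longrightarrow> \<bar>A i j - of_bool (i = j)\<bar> \<le> \<eta>"
    and \<eta>: "\<eta> * real (card I) \<le> 1 / 2"
    and b: "\<And>i. i \<in> I \<Longrightarrow> \<bar>b i\<bar> \<le> c"
  shows "\<exists>h. (\<forall>i\<in>I. (\<Sum>j\<in>I. A i j * h j) = b i) \<and> (\<forall>i\<in>I. \<bar>h i\<bar> \<le> 2 * c)"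
proof -
  have diag: "(\<Sum>j\<in>I. of_bool (i = j) * v j) = v i" if "i \<in> I" for i and v :: "'a \<Rightarrow> real"
  proof -
    have "(\<Sum>j\<in>I. of_bool (i = j) * v j) = (\<Sum>j\<in>I. if i = j then v j else 0)"
      by (intro sum.cong) auto
    then show ?thesis using that fin by (simp add: sum.delta')
  qed
  have bound: "\<bar>v i\<bar> \<le> 2 * e"
    if eq: "\<And>i. i \<in> I \<Longrightarrow> \<bar>\<Sum>j\<in>I. A i j * v j\<bar> \<le> e" and i: "i \<in> I" for v e i
  proof -
    define \<mu> where "\<mu> = Max ((\<lambda>i. \<bar>v i\<bar>) ` I)"
    have le: "\<bar>v j\<bar> \<le> \<mu>" if "j \<in> I" for j
      unfolding \<mu>_def using fin that by auto
    have "\<mu> \<in> (\<lambda>i. \<bar>v i\<bar>) ` I"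
      unfolding \<mu>_def using fin i by (intro Max_in) auto
    then obtain k where k: "k \<in> I" "\<mu> = \<bar>v k\<bar>" by blast
    have "v k = (\<Sum>j\<in>I. A k j * v j) - (\<Sum>j\<in>I. (A k j - of_bool (k = j)) * v j)"
      using diag[OF k(1)] by (simp add: left_diff_distrib sum_subtractf)
    moreover have "\<bar>\<Sum>j\<in>I. (A k j - of_bool (k = j)) * v j\<bar> \<le> \<mu> / 2"
    proof -
      have "\<bar>\<Sum>j\<in>I. (A k j - of_bool (k = j)) * v j\<bar> \<le> (\<Sum>j\<in>I. \<eta> * \<mu>)"
      proof (rule order_trans[OF sum_abs sum_mono])
        fix j assume j: "j \<in> I"
        show "\<bar>(A k j - of_bool (k = j)) * v j\<bar> \<le> \<eta> * \<mu>"
          unfolding abs_mult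
          using near[OF k(1) j] by (intro mult_mono near le k j) linarith+
      qed
      also have "\<dots> = (\<eta> * real (card I)) * \<mu>" by simp
      also have "\<dots> \<le> 1 / 2 * \<mu>"
        using \<eta> k(2) by (intro mult_right_mono) auto
      finally show ?thesis by simp
    qed
    ultimately have "\<mu> \<le> e + \<mu> / 2"
      using eq[OF k(1)] k(2) by linarith
    then show ?thesis using le[OF i] by linarith
  qed
  \<comment> \<open>The index set is numbered so that a determinant can turn injectivity into
    solvability.\<close>
  obtain g where g: "bij_betw g {0..<card I} I"
    using ex_bij_betw_nat_finite[OF fin] by blast
  define k where "k = card I"
  define M where "M = Matrix.mat k k (\<lambda>(r, s). A (g r) (g s))"
  have M: "M \<in> carrier_mat k k" by (simp add: M_def)
  have gin: "g r \<in> I" if "r < k" for r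
    using g that by (auto simp: bij_betw_def k_def)
  define g' where "g' = inv_into {0..<k} g"
  have g': "g' i < k" "g (g' i) = i" if "i \<in> I" for i
  proof -
    show "g (g' i) = i" using bij_betw_inv_into_right[OF g that] by (simp add: g'_def k_def)
    have "i \<in> g ` {0..<k}" using g that by (simp add: bij_betw_def k_def)
    then have "g' i \<in> {0..<k}" unfolding g'_def by (rule inv_into_into)
    then show "g' i < k" by simp
  qed
  have g'g: "g' (g r) = r" if "r < k" for r
    using that bij_betw_inv_into_left[OF g] by (simp add: g'_def k_def)
  have Mv: "(\<Sum>j\<in>I. A i j * h $ g' j) = (M *\<^sub>v h) $ g' i" if h: "h \<in> carrier_vec k" and i: "i \<in> I" for h i
  proof -
    have "(M *\<^sub>v h) $ g' i = (\<Sum>s\<in>{0..<k}. A i (g s) * h $ s)"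
      using h g'[OF i] by (simp add: M_def scalar_prod_def)
    also have "\<dots> = (\<Sum>s\<in>{0..<k}. A i (g s) * h $ g' (g s))"
      using g'g by (intro sum.cong) auto
    also have "\<dots> = (\<Sum>j\<in>I. A i j * h $ g' j)"
      using sum.reindex_bij_betw[OF g, of "\<lambda>j. A i j * h $ g' j"] by (simp add: k_def)
    finally show ?thesis by simp
  qed
  have "Determinant.det M \<noteq> 0"
  proof
    assume "Determinant.det M = 0"
    then obtain v where v: "v \<in> carrier_vec k" "v \<noteq> 0\<^sub>v k" "M *\<^sub>v v = 0\<^sub>v k"
      using det_0_iff_vec_prod_zero_field[OF M] by blast
    have zero: "\<bar>v $ g' i\<bar> \<le> 2 * 0" if "i \<in> I" for i
    proof (rule bound[OF _ that])
      fix i assume i: "i \<in> I"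
      show "\<bar>\<Sum>j\<in>I. A i j * v $ g' j\<bar> \<le> 0"
        using Mv[OF v(1) i] v(3) g'(1)[OF i] by simp
    qed
    then have "v $ r = 0" if "r < k" for r
    proof -
      have "\<bar>v $ g' (g r)\<bar> \<le> 2 * 0" by (rule zero[OF gin[OF that]])
      then show ?thesis using g'g[OF that] by simp
    qed
    then have "v = 0\<^sub>v k" using v(1) by (intro eq_vecI) auto
    with v(2) show False by blast
  qed
  then obtain B where B: "B \<in> carrier_mat k k" "M * B = 1\<^sub>m k"
    using det_nonzero_inverse[OF M] by metis
  define h where "h = B *\<^sub>v (vec k (\<lambda>r. b (g r)))"
  have h: "h \<in> carrier_vec k" using B by (simp add: h_def)
  have "M *\<^sub>v h = vec k (\<lambda>r. b (g r))"
    unfolding h_def using B M by (subst assoc_mult_mat_vec[symmetric]) auto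
  then have sol: "(\<Sum>j\<in>I. A i j * h $ g' j) = b i" if "i \<in> I" for i
    using Mv[OF h that] g'[OF that] by simp
  moreover have "\<bar>h $ g' i\<bar> \<le> 2 * c" if "i \<in> I" for i
    by (rule bound[OF _ that]) (simp add: sol b)
  ultimately show ?thesis by (intro exI[of _ "\<lambda>i. h $ g' i"]) simp
qed

text \<open>Dividing by c + 1 instead of c also covers vanishing constants.\<close>

lemma common_small_scale:
  fixes c1 c2 k1 k2 k3 :: real
  assumes "c1 \<ge> 0" "c2 \<ge> 0" "k1 > 0" "k2 > 0" "k3 > 0"
  shows "\<exists>\<delta>>0. \<delta> * c1 \<le> k1 \<and> \<delta> * c2 \<le> k2 \<and> \<delta> \<le> k3"
proof -
  have *: "\<delta> * c \<le> k" if "\<delta> \<le> k / (c + 1)" "c \<ge> 0" "k > 0" "\<delta> > 0" for \<delta> c k :: real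
  proof -
    have "\<delta> * (c + 1) \<le> k" using that by (simp add: pos_le_divide_eq)
    then show ?thesis using that by (simp add: distrib_left)
  qed
  show ?thesis
    using assms
    by (intro exI[of _ "min (k1 / (c1 + 1)) (min (k2 / (c2 + 1)) k3)"] conjI *) auto
qed

text \<open>\<open>cl\<close> is the class of a vertex and \<open>r a\<close> a root in class
  \<open>a\<close>. Fixing the values at the roots removes the N-dimensional kernel of the block
  Laplacian. In \<open>conn_pair\<close> the paths use only edges between the two classes.
  \<open>nontrivial\<close> provides a vertex that is not a root, so that the stress is not
  zero.\<close>

locale rigid_partition =
  fixes W :: "'v set" and E :: "'v set set" and cl :: "'v \<Rightarrow> nat" and N :: nat and r :: "nat \<Rightarrow> 'v"
  assumes fin: "finite W"
    and cl: "i \<in> W \<Longrightarrow> cl i < N"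
    and root: "a < N \<Longrightarrow> r a \<in> W" "a < N \<Longrightarrow> cl (r a) = a"
    and conn_class: "i \<in> W \<Longrightarrow>
      (r (cl i), i) \<in> {(i, j). i \<in> W \<and> j \<in> W \<and> i \<noteq> j \<and> {i, j} \<in> E \<and> cl i = cl j}\<^sup>*"
    and conn_pair: "a < N \<Longrightarrow> b < N \<Longrightarrow> a \<noteq> b \<Longrightarrow> i \<in> W \<Longrightarrow> j \<in> W \<Longrightarrow>
      cl i \<in> {a, b} \<Longrightarrow> cl j \<in> {a, b} \<Longrightarrow>
      (i, j) \<in> {(i, j). i \<in> W \<and> j \<in> W \<and> {i, j} \<in> E \<and> cl i \<noteq> cl j \<and> cl i \<in> {a, b} \<and> cl j \<in> {a, b}}\<^sup>*"
    and nontrivial: "\<exists>v\<in>W. v \<noteq> r (cl v)"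
begin

section \<open>Infinitesimal rigidity: reaching every matrix\<close>

definition pattern :: "('v \<Rightarrow> 'v \<Rightarrow> real) \<Rightarrow> bool" where
  "pattern K \<longleftrightarrow> (\<forall>i j. K i j = K j i) \<and>
     (\<forall>i j. K i j \<noteq> 0 \<longrightarrow> i \<in> W \<and> j \<in> W \<and> (i = j \<or> {i, j} \<in> E))"

text \<open>The range of \<open>(K, A) \<mapsto> K x + x A\<close> at the matrix \<open>x\<close> whose rows are the unit
  vectors of the classes; \<open>A\<close> is antisymmetric.\<close>

definition reach :: "('v \<Rightarrow> nat \<Rightarrow> real) \<Rightarrow> bool" where
  "reach Y \<longleftrightarrow> (\<exists>K A. pattern K \<and> (\<forall>a b. A a b = - A b a) \<and>
     (\<forall>i\<in>W. \<forall>a<N. Y i a = (\<Sum>j\<in>W. K i j * of_bool (cl j = a)) + A (cl i) a))"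

abbreviation e :: "'v \<Rightarrow> nat \<Rightarrow> 'v \<Rightarrow> nat \<Rightarrow> real" where
  "e k c \<equiv> \<lambda>i a. of_bool (i = k \<and> a = c)"

lemma pattern_0: "pattern (\<lambda>_ _. 0)"
  by (simp add: pattern_def)

lemma pattern_add: "pattern K \<Longrightarrow> pattern L \<Longrightarrow> pattern (\<lambda>i j. K i j + L i j)"
proof -
  assume K: "pattern K" and L: "pattern L"
  have "i \<in> W \<and> j \<in> W \<and> (i = j \<or> {i, j} \<in> E)" if "K i j + L i j \<noteq> 0" for i j
  proof (cases "K i j = 0")
    case True
    then have "L i j \<noteq> 0" using that by simp
    with L show ?thesis unfolding pattern_def by blast
  next
    case False with K show ?thesis unfolding pattern_def by blast
  qed
  moreover have "K i j + L i j = K j i + L j i" for i j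
    using K L unfolding pattern_def by metis
  ultimately show ?thesis unfolding pattern_def by blast
qed

lemma pattern_scale: "pattern K \<Longrightarrow> pattern (\<lambda>i j. s * K i j)"
proof -
  assume K: "pattern K"
  have "i \<in> W \<and> j \<in> W \<and> (i = j \<or> {i, j} \<in> E)" if "s * K i j \<noteq> 0" for i j
  proof -
    have "K i j \<noteq> 0" using that by auto
    with K show ?thesis unfolding pattern_def by blast
  qed
  moreover have "s * K i j = s * K j i" for i j
    using K unfolding pattern_def by metis
  ultimately show ?thesis unfolding pattern_def by blast
qed

lemma pattern_sum: "finite P \<Longrightarrow> (\<And>p. p \<in> P \<Longrightarrow> pattern (f p)) \<Longrightarrow> pattern (\<lambda>i j. \<Sum>p\<in>P. f p i j)"
proof (induction P rule: finite_induct)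
  case empty
  show ?case by (simp add: pattern_0)
next
  case (insert p P)
  then have "pattern (\<lambda>i j. f p i j + (\<Sum>p\<in>P. f p i j))" by (intro pattern_add) auto
  with insert.hyps show ?case by simp
qed

lemma reach_cong: "reach Y \<Longrightarrow> (\<And>i a. i \<in> W \<Longrightarrow> a < N \<Longrightarrow> Y i a = Z i a) \<Longrightarrow> reach Z"
proof -
  assume Y: "reach Y" and eq: "\<And>i a. i \<in> W \<Longrightarrow> a < N \<Longrightarrow> Y i a = Z i a"
  obtain K A where 1: "pattern K" "\<forall>a b. A a b = - A b a"
    "\<And>i a. i \<in> W \<Longrightarrow> a < N \<Longrightarrow> Y i a = (\<Sum>j\<in>W. K i j * of_bool (cl j = a)) + A (cl i) a"
    using Y unfolding reach_def by blast
  have "\<forall>i\<in>W. \<forall>a<N. Z i a = (\<Sum>j\<in>W. K i j * of_bool (cl j = a)) + A (cl i) a"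
    using 1(3) eq by metis
  with 1(1,2) show ?thesis unfolding reach_def by blast
qed

lemma reach_add:
  assumes "reach Y" "reach Z" shows "reach (\<lambda>i a. Y i a + Z i a)"
proof -
  obtain K A where 1: "pattern K" "\<And>a b. A a b = - A b a"
    "\<And>i a. i \<in> W \<Longrightarrow> a < N \<Longrightarrow> Y i a = (\<Sum>j\<in>W. K i j * of_bool (cl j = a)) + A (cl i) a"
    using assms(1) unfolding reach_def by blast
  obtain L B where 2: "pattern L" "\<And>a b. B a b = - B b a"
    "\<And>i a. i \<in> W \<Longrightarrow> a < N \<Longrightarrow> Z i a = (\<Sum>j\<in>W. L i j * of_bool (cl j = a)) + B (cl i) a"
    using assms(2) unfolding reach_def by blast
  show ?thesis unfolding reach_def
  proof (intro exI[of _ "\<lambda>i j. K i j + L i j"] exI[of _ "\<lambda>a b. A a b + B a b"] conjI allI ballI impI)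
    show "pattern (\<lambda>i j. K i j + L i j)" using 1(1) 2(1) by (rule pattern_add)
    show "A a b + B a b = - (A b a + B b a)" for a b using 1(2)[of a b] 2(2)[of a b] by simp
  qed (simp add: 1(3) 2(3) distrib_right sum.distrib)
qed

lemma reach_scale:
  assumes "reach Y" shows "reach (\<lambda>i a. s * Y i a)"
proof -
  obtain K A where 1: "pattern K" "\<And>a b. A a b = - A b a"
    "\<And>i a. i \<in> W \<Longrightarrow> a < N \<Longrightarrow> Y i a = (\<Sum>j\<in>W. K i j * of_bool (cl j = a)) + A (cl i) a"
    using assms(1) unfolding reach_def by blast
  show ?thesis unfolding reach_def
  proof (intro exI[of _ "\<lambda>i j. s * K i j"] exI[of _ "\<lambda>a b. s * A a b"] conjI allI ballI impI)
    show "pattern (\<lambda>i j. s * K i j)" using 1(1) by (rule pattern_scale)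
    show "s * A a b = - (s * A b a)" for a b using 1(2)[of a b] by simp
  qed (simp add: 1(3) distrib_left sum_distrib_left mult.assoc)
qed

lemma reach_sum: "finite P \<Longrightarrow> (\<And>p. p \<in> P \<Longrightarrow> reach (f p)) \<Longrightarrow> reach (\<lambda>i a. \<Sum>p\<in>P. f p i a)"
proof (induction P rule: finite_induct)
  case empty
  show ?case unfolding reach_def
    by (rule exI[of _ "\<lambda>_ _. 0"], rule exI[of _ "\<lambda>_ _. 0"]) (simp add: pattern_0)
next
  case (insert p P)
  then have "reach (\<lambda>i a. f p i a + (\<Sum>p\<in>P. f p i a))" by (intro reach_add) auto
  with insert.hyps show ?case by simp
qed

lemma reach_diag:
  assumes "k \<in> W" shows "reach (e k (cl k))"
  unfolding reach_def
proof (intro exI[of _ "\<lambda>i j. of_bool (i = k \<and> j = k)"] exI[of _ "\<lambda>_ _. 0"] conjI ballI allI impI)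
  show "pattern (\<lambda>i j. of_bool (i = k \<and> j = k))"
    using assms by (auto simp: pattern_def)
  fix i a
  have "(\<Sum>j\<in>W. of_bool (i = k \<and> j = k) * of_bool (cl j = a)) =
        (\<Sum>j\<in>W. if j = k then of_bool (i = k \<and> cl k = a) else (0::real))"
    by (intro sum.cong) auto
  then show "e k (cl k) i a = (\<Sum>j\<in>W. of_bool (i = k \<and> j = k) * of_bool (cl j = a)) + (0::real)"
    using assms fin by (auto simp: sum.delta)
qed simp

text \<open>A symmetric pair of entries of K puts the unit vector of the class of \<open>k\<close>
  into row \<open>j\<close> and vice versa; it cannot do one without the other. Separating the two
  is the task of the antisymmetric part.\<close>

lemma reach_edge:
  assumes "j \<in> W" "k \<in> W" "j \<noteq> k" "{j, k} \<in> E"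
  shows "reach (\<lambda>i a. e j (cl k) i a + e k (cl j) i a)"
  unfolding reach_def
proof (intro exI[of _ "\<lambda>i l. of_bool (i = j \<and> l = k) + of_bool (i = k \<and> l = j)"]
    exI[of _ "\<lambda>_ _. 0"] conjI ballI allI impI)
  show "pattern (\<lambda>i l. of_bool (i = j \<and> l = k) + of_bool (i = k \<and> l = j))"
    using assms by (auto simp: pattern_def insert_commute)
  fix i a
  have "(\<Sum>l\<in>W. (of_bool (i = j \<and> l = k) + of_bool (i = k \<and> l = j)) * of_bool (cl l = a)) =
        (\<Sum>l\<in>W. (if l = k then of_bool (i = j \<and> cl k = a) else (0::real)) +
                (if l = j then of_bool (i = k \<and> cl j = a) else (0::real)))"
    by (intro sum.cong) auto
  also have "\<dots> = of_bool (i = j \<and> cl k = a) + of_bool (i = k \<and> cl j = a)"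
    using assms fin by (simp add: sum.distrib sum.delta)
  finally show "e j (cl k) i a + e k (cl j) i a =
     (\<Sum>l\<in>W. (of_bool (i = j \<and> l = k) + of_bool (i = k \<and> l = j)) * of_bool (cl l = a)) + (0::real)"
    by auto
qed simp

text \<open>For c = \<open>cl k\<close> a diagonal entry suffices. Otherwise take the two classes a
  = \<open>cl k\<close> and c. Modulo \<open>reach\<close>, crossing an edge between them replaces
  the basis matrix at one end by minus that at the other, so by connectivity all signed basis
  matrices agree. The antisymmetric unit matrix reaches their sum over both classes, hence each of
  them.\<close>

lemma reach_basis:
  assumes "k \<in> W" "c < N" shows "reach (e k c)"
proof (cases "c = cl k")
  case True then show ?thesis using reach_diag[OF assms(1)] by simp
next
  case False
  define a where "a = cl k"
  have a: "a < N" "a \<noteq> c" using cl[OF assms(1)] False by (auto simp: a_def)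
  define oth where "oth i = (if cl i = a then c else a)" for i
  \<comment> \<open>The two-colouring of the bipartite graph absorbs the sign change at each
    edge.\<close>
  define s :: "'v \<Rightarrow> real" where "s i = (if cl i = a then 1 else - 1)" for i
  define P where "P = {i\<in>W. cl i \<in> {a, c}}"
  have finP: "finite P" using fin by (simp add: P_def)
  have kP: "k \<in> P" using assms by (simp add: P_def a_def)
  have walk: "reach (\<lambda>i b. s k * e k (oth k) i b - s j * e j (oth j) i b)"
    if "(k, j) \<in> {(i, j). i \<in> W \<and> j \<in> W \<and> {i, j} \<in> E \<and> cl i \<noteq> cl j \<and> cl i \<in> {a, c} \<and> cl j \<in> {a, c}}\<^sup>*" for j
    using that
  proof (induction rule: rtrancl_induct)
    case base
    show ?case using reach_scale[OF reach_diag[OF assms(1)], of 0] by simp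
  next
    case (step j l)
    have jl: "j \<in> W" "l \<in> W" "{j, l} \<in> E" "cl j \<noteq> cl l" "cl j \<in> {a, c}" "cl l \<in> {a, c}"
      using step.hyps by auto
    then have o: "oth j = cl l" "oth l = cl j" "s l = - s j" "j \<noteq> l"
      using a by (auto simp: oth_def s_def)
    have "reach (\<lambda>i b. (s k * e k (oth k) i b - s j * e j (oth j) i b) +
        s j * (e j (cl l) i b + e l (cl j) i b))"
      by (intro reach_add step.IH reach_scale reach_edge jl o)
    then show ?case
      by (rule reach_cong) (simp add: o algebra_simps)
  qed
  have sum: "reach (\<lambda>i b. \<Sum>j\<in>P. s k * e k (oth k) i b - s j * e j (oth j) i b)"
  proof (intro reach_sum finP walk)
    fix j assume "j \<in> P"
    then show "(k, j) \<in> {(i, j). i \<in> W \<and> j \<in> W \<and> {i, j} \<in> E \<and> cl i \<noteq> cl j \<and> cl i \<in> {a, c} \<and> cl j \<in> {a, c}}\<^sup>*"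
      using conn_pair[of a c k j] a assms kP by (auto simp: P_def)
  qed
  \<comment> \<open>Take K = 0 and A with entry 1 at (a, c) and -1 at (c, a): a row of x A is a row
    of A, selected by the class of the vertex.\<close>
  have alt: "reach (\<lambda>i b. \<Sum>j\<in>P. s j * e j (oth j) i b)"
    unfolding reach_def
  proof (intro exI[of _ "\<lambda>(_::'v) (_::'v). 0"]
      exI[of _ "\<lambda>u v. of_bool (u = a \<and> v = c) - of_bool (u = c \<and> v = a)"] conjI ballI allI impI)
    fix i b assume i: "i \<in> W"
    have "(\<Sum>j\<in>P. s j * e j (oth j) i b) = (\<Sum>j\<in>P. if j = i then s i * of_bool (b = oth i) else 0)"
      by (intro sum.cong) auto
    also have "\<dots> = of_bool (cl i = a \<and> b = c) - of_bool (cl i = c \<and> b = a)"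
      using finP i a by (auto simp: sum.delta P_def s_def oth_def)
    finally show "(\<Sum>j\<in>P. s j * e j (oth j) i b) = (\<Sum>j\<in>W. 0 * of_bool (cl j = b)) +
       (of_bool (cl i = a \<and> b = c) - of_bool (cl i = c \<and> b = a))" by simp
  next
    show "pattern (\<lambda>_ _. 0)" by (rule pattern_0)
  next
    fix u v
    show "of_bool (u = a \<and> v = c) - of_bool (u = c \<and> v = a) =
       - (of_bool (v = a \<and> u = c) - of_bool (v = c \<and> u = a) :: real)"
      by (simp only: minus_diff_eq conj_commute)
  qed
  \<comment> \<open>In the sum of \<open>sum\<close> and \<open>alt\<close> the terms at
    \<open>j\<close> cancel and \<open>card P\<close> copies of the term at \<open>k\<close> are
    left.\<close>
  have "reach (\<lambda>i b. (1 / (real (card P) * s k)) *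
     ((\<Sum>j\<in>P. s k * e k (oth k) i b - s j * e j (oth j) i b) + (\<Sum>j\<in>P. s j * e j (oth j) i b)))"
    by (rule reach_scale[OF reach_add[OF sum alt]])
  moreover have "real (card P) * s k \<noteq> 0"
    using finP kP by (auto simp: s_def)
  ultimately have "reach (e k (oth k))"
    by (rule_tac reach_cong) (simp_all add: sum_subtractf)
  then show ?thesis by (simp add: oth_def a_def)
qed

section \<open>The Laplacian of the edges inside classes, and its coercivity\<close>

definition lap :: "'v \<Rightarrow> 'v \<Rightarrow> real" where
  "lap i j = (let w = (\<lambda>i j. of_bool (i \<in> W \<and> j \<in> W \<and> i \<noteq> j \<and> {i, j} \<in> E \<and> cl i = cl j)) in
     (if i = j then \<Sum>l\<in>W. w i l else 0) - w i j)"

text \<open>The Dirichlet energy over ordered pairs, so every edge is counted twice; this is the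
  factor 2 in \<open>lap_energy\<close>.\<close>

definition energy :: "('v \<Rightarrow> real) \<Rightarrow> real" where
  "energy v = (\<Sum>i\<in>W. \<Sum>j\<in>W. of_bool (i \<noteq> j \<and> {i, j} \<in> E \<and> cl i = cl j) * (v i - v j)\<^sup>2)"

lemma pattern_lap: "pattern lap"
  unfolding pattern_def
proof (intro conjI allI impI)
  show "lap i j = lap j i" for i j
    by (auto simp: lap_def insert_commute)
  fix i j assume ne: "lap i j \<noteq> 0"
  have W: "i \<in> W"
  proof (rule ccontr)
    assume i: "i \<notin> W"
    have "lap i j = 0" unfolding lap_def Let_def using i by (cases "i = j") auto
    with ne show False by simp
  qed
  then show "i \<in> W" "j \<in> W" "i = j \<or> {i, j} \<in> E"
    using ne by (auto simp: lap_def Let_def split: if_splits)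
qed

lemma lap_row: "i \<in> W \<Longrightarrow> (\<Sum>j\<in>W. lap i j * of_bool (cl j = a)) = 0"
proof -
  assume i: "i \<in> W"
  define w where "w i j = (of_bool (i \<in> W \<and> j \<in> W \<and> i \<noteq> j \<and> {i, j} \<in> E \<and> cl i = cl j) :: real)" for i j
  have "(\<Sum>j\<in>W. lap i j * of_bool (cl j = a)) =
     (\<Sum>j\<in>W. (if j = i then (\<Sum>l\<in>W. w i l) * of_bool (cl i = a) else 0) - w i j * of_bool (cl j = a))"
    by (intro sum.cong) (auto simp: lap_def w_def Let_def)
  also have "\<dots> = (\<Sum>l\<in>W. w i l) * of_bool (cl i = a) - (\<Sum>j\<in>W. w i j * of_bool (cl j = a))"
    using i fin by (simp add: sum_subtractf sum.delta)
  also have "(\<Sum>j\<in>W. w i j * of_bool (cl j = a)) = (\<Sum>j\<in>W. w i j * of_bool (cl i = a))"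
    by (intro sum.cong) (auto simp: w_def)
  finally show ?thesis by (simp add: sum_distrib_right)
qed

lemma lap_energy: "2 * (\<Sum>i\<in>W. \<Sum>j\<in>W. v i * lap i j * v j) = energy v"
proof -
  define w where "w i j = (of_bool (i \<in> W \<and> j \<in> W \<and> i \<noteq> j \<and> {i, j} \<in> E \<and> cl i = cl j) :: real)" for i j
  have wsym: "w i j = w j i" for i j by (simp add: w_def insert_commute conj_ac eq_commute)
  have 1: "(\<Sum>j\<in>W. v i * lap i j * v j) = (\<Sum>j\<in>W. w i j * (v i)\<^sup>2) - (\<Sum>j\<in>W. w i j * (v i * v j))"
    if "i \<in> W" for i
  proof -
    have "(\<Sum>j\<in>W. v i * lap i j * v j) =
      (\<Sum>j\<in>W. (if j = i then (\<Sum>l\<in>W. w i l) * (v i)\<^sup>2 else 0) - w i j * (v i * v j))"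
      by (intro sum.cong) (auto simp: lap_def w_def Let_def power2_eq_square algebra_simps)
    also have "\<dots> = (\<Sum>l\<in>W. w i l) * (v i)\<^sup>2 - (\<Sum>j\<in>W. w i j * (v i * v j))"
      using that fin by (simp add: sum_subtractf sum.delta)
    finally show ?thesis by (simp add: sum_distrib_right)
  qed
  have "energy v = (\<Sum>i\<in>W. \<Sum>j\<in>W. w i j * (v i)\<^sup>2 + w j i * (v j)\<^sup>2 - 2 * (w i j * (v i * v j)))"
    unfolding energy_def
    by (intro sum.cong refl)
       (subst wsym, simp add: w_def power2_eq_square algebra_simps insert_commute)
  also have "\<dots> = (\<Sum>i\<in>W. \<Sum>j\<in>W. w i j * (v i)\<^sup>2) + (\<Sum>i\<in>W. \<Sum>j\<in>W. w j i * (v j)\<^sup>2)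
     - 2 * (\<Sum>i\<in>W. \<Sum>j\<in>W. w i j * (v i * v j))"
    by (simp add: sum.distrib sum_subtractf sum_distrib_left)
  also have "(\<Sum>i\<in>W. \<Sum>j\<in>W. w j i * (v j)\<^sup>2) = (\<Sum>i\<in>W. \<Sum>j\<in>W. w i j * (v i)\<^sup>2)"
    by (rule sum.swap)
  finally show ?thesis by (simp add: 1 sum_subtractf)
qed

lemma energy_nonneg: "energy v \<ge> 0"
  unfolding energy_def by (intro sum_nonneg) auto

lemma energy_edge:
  assumes "i \<in> W" "j \<in> W" "i \<noteq> j" "{i, j} \<in> E" "cl i = cl j"
  shows "\<bar>v i - v j\<bar> \<le> sqrt (energy v)"
proof -
  have "(v i - v j)\<^sup>2 = of_bool (i \<noteq> j \<and> {i, j} \<in> E \<and> cl i = cl j) * (v i - v j)\<^sup>2"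
    using assms by simp
  also have "\<dots> \<le> (\<Sum>j\<in>W. of_bool (i \<noteq> j \<and> {i, j} \<in> E \<and> cl i = cl j) * (v i - v j)\<^sup>2)"
    by (rule member_le_sum[OF assms(2), of "\<lambda>j. of_bool (i \<noteq> j \<and> {i, j} \<in> E \<and> cl i = cl j) * (v i - v j)\<^sup>2"])
       (use fin in auto)
  also have "\<dots> \<le> energy v"
    unfolding energy_def
    by (rule member_le_sum[OF assms(1), of "\<lambda>i. \<Sum>j\<in>W. of_bool (i \<noteq> j \<and> {i, j} \<in> E \<and> cl i = cl j) * (v i - v j)\<^sup>2"])
       (use fin in \<open>auto intro!: sum_nonneg\<close>)
  finally show ?thesis by (simp add: real_le_rsqrt)
qed

text \<open>Along an edge inside a class a function changes by at most the root of its energy, so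
  the length of a walk from the root of the class is an admissible constant for a vertex. Summing
  these constants makes them uniform.\<close>

lemma poincare:
  "\<exists>C\<ge>0. \<forall>v. (\<forall>a<N. v (r a) = 0) \<longrightarrow> (\<forall>i\<in>W. \<bar>v i\<bar> \<le> C * sqrt (energy v))"
proof -
  have "\<exists>C\<ge>0. \<forall>v. \<bar>v j - v k\<bar> \<le> C * sqrt (energy v)"
    if "(k, j) \<in> {(i, j). i \<in> W \<and> j \<in> W \<and> i \<noteq> j \<and> {i, j} \<in> E \<and> cl i = cl j}\<^sup>*" for k j
    using that
  proof (induction rule: rtrancl_induct)
    case base show ?case by (intro exI[of _ 0]) auto
  next
    case (step j l)
    then obtain C where C: "C \<ge> 0" "\<And>v. \<bar>v j - v k\<bar> \<le> C * sqrt (energy v)" by blast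
    have "\<bar>v l - v k\<bar> \<le> (C + 1) * sqrt (energy v)" for v
      using C(2)[of v] energy_edge[of j l v] step.hyps(2) by (simp add: distrib_right)
    with C(1) show ?case by (intro exI[of _ "C + 1"]) auto
  qed
  then have "\<forall>i\<in>W. \<exists>C\<ge>0. \<forall>v. \<bar>v i - v (r (cl i))\<bar> \<le> C * sqrt (energy v)"
    using conn_class by blast
  then obtain C where C: "\<And>i. i \<in> W \<Longrightarrow> C i \<ge> 0"
    "\<And>i v. i \<in> W \<Longrightarrow> \<bar>v i - v (r (cl i))\<bar> \<le> C i * sqrt (energy v)"
    by metis
  show ?thesis
  proof (intro exI[of _ "\<Sum>i\<in>W. C i"] conjI allI impI ballI)
    show "0 \<le> sum C W" by (intro sum_nonneg C)
    fix v :: "'v \<Rightarrow> real" and i assume v: "\<forall>a<N. v (r a) = 0" and i: "i \<in> W"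
    have "\<bar>v i\<bar> \<le> C i * sqrt (energy v)" using C(2)[OF i, of v] v cl[OF i] by simp
    also have "\<dots> \<le> sum C W * sqrt (energy v)"
      using i fin C(1) energy_nonneg by (intro mult_right_mono member_le_sum) auto
    finally show "\<bar>v i\<bar> \<le> sum C W * sqrt (energy v)" .
  qed
qed

lemma card_W_pos: "card W > 0"
  using nontrivial fin by (auto simp: card_gt_0_iff)

lemma N_pos: "N > 0"
  using nontrivial cl by force

text \<open>Since \<open>A\<close> is antisymmetric and \<open>x\<^sup>T K x\<close> symmetric, \<open>K x = - x A\<close> gives
  \<open>|x A|\<^sup>2 = - \<langle>x A, K x\<rangle> = 0\<close>.\<close>

lemma antisymmetric_correction_vanishes:
  fixes x :: "'v \<Rightarrow> nat \<Rightarrow> real"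
  assumes K: "\<And>i j. K i j = K j i" and A: "\<And>a b. A a b = - A b a"
    and eq: "\<And>i a. i \<in> W \<Longrightarrow> a < N \<Longrightarrow> (\<Sum>j\<in>W. K i j * x j a) = - (\<Sum>b<N. x i b * A b a)"
    and i: "i \<in> W" and a: "a < N"
  shows "(\<Sum>j\<in>W. K i j * x j a) = 0"
proof -
  define Q where "Q b a = (\<Sum>i\<in>W. \<Sum>j\<in>W. x i b * K i j * x j a)" for a b
  have Qsym: "Q b a = Q a b" for a b
    unfolding Q_def by (subst sum.swap) (intro sum.cong refl, simp add: K mult_ac)
  define y where "y i a = (\<Sum>j\<in>W. K i j * x j a)" for i a
  have "(y i a)\<^sup>2 = - (\<Sum>b<N. A b a * (x i b * y i a))" if "i \<in> W" "a \<in> {..<N}" for i a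
  proof -
    have "(y i a)\<^sup>2 = (- (\<Sum>b<N. x i b * A b a)) * y i a"
      using eq[of i a] that by (simp add: power2_eq_square y_def)
    then show ?thesis by (simp add: sum_distrib_right sum_distrib_left mult_ac)
  qed
  then have "(\<Sum>i\<in>W. \<Sum>a<N. (y i a)\<^sup>2) = (\<Sum>i\<in>W. \<Sum>a<N. - (\<Sum>b<N. A b a * (x i b * y i a)))"
    by (intro sum.cong) auto
  also have "\<dots> = - (\<Sum>i\<in>W. \<Sum>a<N. \<Sum>b<N. A b a * (x i b * y i a))"
    by (simp only: sum_negf)
  also have "(\<Sum>i\<in>W. \<Sum>a<N. \<Sum>b<N. A b a * (x i b * y i a)) = (\<Sum>a<N. \<Sum>b<N. A b a * Q b a)"
  proof -
    have "(\<Sum>i\<in>W. \<Sum>a<N. \<Sum>b<N. A b a * (x i b * y i a)) = (\<Sum>a<N. \<Sum>i\<in>W. \<Sum>b<N. A b a * (x i b * y i a))"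
      by (rule sum.swap)
    also have "\<dots> = (\<Sum>a<N. \<Sum>b<N. \<Sum>i\<in>W. A b a * (x i b * y i a))"
      by (intro sum.cong refl sum.swap)
    also have "\<dots> = (\<Sum>a<N. \<Sum>b<N. A b a * Q b a)"
      by (simp add: Q_def y_def sum_distrib_left mult.assoc)
    finally show ?thesis .
  qed
  also have "(\<Sum>a<N. \<Sum>b<N. A b a * Q b a) = 0"
  proof -
    define T where "T = (\<Sum>a<N. \<Sum>b<N. A b a * Q b a)"
    have "T = (\<Sum>a<N. \<Sum>b<N. A a b * Q a b)" unfolding T_def by (rule sum.swap)
    also have "\<dots> = (\<Sum>a<N. \<Sum>b<N. - (A b a * Q b a))"
    proof (intro sum.cong refl)
      fix a b
      show "A a b * Q a b = - (A b a * Q b a)"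
        unfolding A[of a b] Qsym[of b a] by (simp only: mult_minus_left)
    qed
    also have "\<dots> = - T" unfolding T_def by (simp add: sum_negf)
    finally have "T = 0" by simp
    then show ?thesis unfolding T_def .
  qed
  finally have "(\<Sum>i\<in>W. \<Sum>a<N. (y i a)\<^sup>2) = 0" by simp
  then have "(\<Sum>a<N. (y i a)\<^sup>2) = 0"
    using i fin by (subst (asm) sum_nonneg_eq_0_iff) (auto intro: sum_nonneg)
  then have "(y i a)\<^sup>2 = 0"
    using a by (subst (asm) sum_nonneg_eq_0_iff) auto
  then show ?thesis by (simp add: y_def)
qed


text \<open>The stress is \<open>lap\<close> plus a small correction \<open>D\<close>. Preimages of
  the basis matrices are fixed once, at the exact partition; for nearby \<open>x\<close> they still
  span, so \<open>D\<close> can be sought among their combinations and is as small as the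
  perturbation.\<close>

lemma stress_near_partition:
  "\<exists>\<delta>>0. \<forall>x. (\<forall>i\<in>W. \<forall>a<N. \<bar>x i a - of_bool (cl i = a)\<bar> \<le> \<delta>) \<longrightarrow>
     (\<exists>K. pattern K \<and> (\<forall>v. 0 \<le> (\<Sum>i\<in>W. \<Sum>j\<in>W. v i * K i j * v j)) \<and> (\<exists>i j. K i j \<noteq> 0) \<and>
        (\<forall>i\<in>W. \<forall>a<N. (\<Sum>j\<in>W. K i j * x j a) = 0))"
proof -
  define I where "I = W \<times> {..<N}"
  have finI: "finite I" using fin by (simp add: I_def)
  \<comment> \<open>A choice of preimages (K, A) for all basis matrices, that is, a right inverse of
    the rigidity map.\<close>
  have "\<forall>p\<in>I. \<exists>F. pattern (fst F) \<and> (\<forall>a b. snd F a b = - snd F b a) \<and>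
     (\<forall>i\<in>W. \<forall>a<N. e (fst p) (snd p) i a = (\<Sum>j\<in>W. fst F i j * of_bool (cl j = a)) + snd F (cl i) a)"
  proof
    fix p assume "p \<in> I"
    then have "reach (e (fst p) (snd p))" using reach_basis by (auto simp: I_def)
    then obtain K A where "pattern K" "\<forall>a b. A a b = - A b a"
      "\<forall>i\<in>W. \<forall>a<N. e (fst p) (snd p) i a = (\<Sum>j\<in>W. K i j * of_bool (cl j = a)) + A (cl i) a"
      unfolding reach_def by blast
    then show "\<exists>F. pattern (fst F) \<and> (\<forall>a b. snd F a b = - snd F b a) \<and>
     (\<forall>i\<in>W. \<forall>a<N. e (fst p) (snd p) i a = (\<Sum>j\<in>W. fst F i j * of_bool (cl j = a)) + snd F (cl i) a)"
      by (intro exI[of _ "(K, A)"], unfold fst_conv snd_conv) blast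
  qed
  then obtain F where F: "\<forall>p\<in>I. pattern (fst (F p)) \<and> (\<forall>a b. snd (F p) a b = - snd (F p) b a) \<and>
     (\<forall>i\<in>W. \<forall>a<N. e (fst p) (snd p) i a = (\<Sum>j\<in>W. fst (F p) i j * of_bool (cl j = a)) + snd (F p) (cl i) a)"
    by (rule bchoice[THEN exE])
  define Kf where "Kf p = fst (F p)" for p
  define Af where "Af p = snd (F p)" for p
  have Kf: "pattern (Kf p)" if "p \<in> I" for p using F that by (simp add: Kf_def)
  have Af: "Af p a b = - Af p b a" if "p \<in> I" for p a b
    using F that unfolding Af_def by blast
  have basis: "of_bool ((i, a) = p) = (\<Sum>j\<in>W. Kf p i j * of_bool (cl j = a)) + Af p (cl i) a"
    if "p \<in> I" "i \<in> W" "a < N" for p i a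
  proof -
    have "e (fst p) (snd p) i a = (\<Sum>j\<in>W. Kf p i j * of_bool (cl j = a)) + Af p (cl i) a"
      using F that unfolding Kf_def Af_def by blast
    moreover have "(i = fst p \<and> a = snd p) = ((i, a) = p)" by (cases p) auto
    ultimately show ?thesis by (simp only:)
  qed
  obtain B1 where B1: "B1 \<ge> 0" "\<And>t. t \<in> I \<times> W \<times> W \<Longrightarrow> \<bar>(\<lambda>(p, i, j). Kf p i j) t\<bar> \<le> B1"
    using finite_abs_bound[of "I \<times> W \<times> W"] finI fin by blast
  obtain B2 where B2: "B2 \<ge> 0" "\<And>t. t \<in> I \<times> {..<N} \<times> {..<N} \<Longrightarrow> \<bar>(\<lambda>(p, a, b). Af p a b) t\<bar> \<le> B2"
    using finite_abs_bound[of "I \<times> {..<N} \<times> {..<N}"] finI by blast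
  obtain B3 where B3: "B3 \<ge> 0" "\<And>t. t \<in> W \<times> W \<Longrightarrow> \<bar>(\<lambda>(i, j). lap i j) t\<bar> \<le> B3"
    using finite_abs_bound[of "W \<times> W"] fin by blast
  define B where "B = B1 + B2 + B3"
  have B: "B \<ge> 0" using B1(1) B2(1) B3(1) by (simp add: B_def)
  have BK: "\<bar>Kf p i j\<bar> \<le> B" if "p \<in> I" "i \<in> W" "j \<in> W" for p i j
    using B1(2)[of "(p, i, j)"] that B2(1) B3(1) by (simp add: B_def)
  have BA: "\<bar>Af p a b\<bar> \<le> B" if "p \<in> I" "a < N" "b < N" for p a b
    using B2(2)[of "(p, a, b)"] that B1(1) B3(1) by (simp add: B_def)
  have BL: "\<bar>lap i j\<bar> \<le> B" if "i \<in> W" "j \<in> W" for i j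
    using B3(2)[of "(i, j)"] that B1(1) B2(1) by (simp add: B_def)
  define m where "m = real (card W)"
  define n where "n = real N"
  have m: "m > 0" and n: "n > 0" using card_W_pos N_pos by (simp_all add: m_def n_def)
  have cardI: "real (card I) = m * n" by (simp add: I_def card_cartesian_product m_def n_def)
  obtain C where C: "C \<ge> 0" "\<And>v i. (\<forall>a<N. v (r a) = 0) \<Longrightarrow> i \<in> W \<Longrightarrow> \<bar>v i\<bar> \<le> C * sqrt (energy v)"
    using poincare by blast
  \<comment> \<open>Entries of \<open>D\<close> of this size change the form by at most m^2 C^2
    \<epsilon> times the energy, hence by at most a quarter of the energy, against the half supplied
    by \<open>lap\<close>.\<close>
  define \<epsilon> where "\<epsilon> = 1 / (4 * (m\<^sup>2 * C\<^sup>2 + 1))"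
  have den: "m\<^sup>2 * C\<^sup>2 + 1 > 0" by (simp add: add_nonneg_pos)
  have \<epsilon>: "\<epsilon> > 0" using den by (simp add: \<epsilon>_def)
  have \<epsilon>': "m\<^sup>2 * C\<^sup>2 * \<epsilon> \<le> 1 / 4" using den by (simp add: \<epsilon>_def field_simps)
  \<comment> \<open>The three requirements make the correction system nearly the identity, the
    entries of \<open>D\<close> at most \<epsilon>, and the matrix of data at the roots
    invertible.\<close>
  obtain \<delta> where \<delta>: "\<delta> > 0" "\<delta> * ((m * B + n * B) * (m * n)) \<le> 1 / 2"
    "\<delta> * (m * n * (2 * (m * B)) * B) \<le> \<epsilon>" "\<delta> \<le> 1 / (2 * n)"
    using common_small_scale[of "(m * B + n * B) * (m * n)" "m * n * (2 * (m * B)) * B" "1 / 2" \<epsilon> "1 / (2 * n)"]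
      B m n \<epsilon> by auto
  show ?thesis
  proof (intro exI[of _ \<delta>] conjI allI impI)
    fix x :: "'v \<Rightarrow> nat \<Rightarrow> real"
    assume "\<forall>i\<in>W. \<forall>a<N. \<bar>x i a - of_bool (cl i = a)\<bar> \<le> \<delta>"
    then have near: "\<bar>x i a - of_bool (cl i = a)\<bar> \<le> \<delta>" if "i \<in> W" "a < N" for i a
      using that by blast
    \<comment> \<open>\<open>M\<close> is the rigidity map at \<open>x\<close> composed with the
      right inverse chosen at the partition, so it is the identity when \<open>x\<close> is the
      partition. The right-hand side \<open>g\<close> is - \<open>lap\<close> x, small because
      \<open>lap\<close> annihilates the partition.\<close>
    define M where "M p q = (\<Sum>j\<in>W. Kf q (fst p) j * x j (snd p)) + (\<Sum>b<N. x (fst p) b * Af q b (snd p))" for p q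
    define g where "g p = - (\<Sum>j\<in>W. lap (fst p) j * x j (snd p))" for p
    have Mnear: "\<bar>M p q - of_bool (p = q)\<bar> \<le> \<delta> * (m * B + n * B)" if pI: "p \<in> I" and qI: "q \<in> I" for p q
    proof -
      obtain i a where p: "p = (i, a)" "i \<in> W" "a < N" using pI by (auto simp: I_def)
      have "(\<Sum>b<N. of_bool (cl i = b) * Af q b a) = (\<Sum>b<N. if b = cl i then Af q (cl i) a else 0)"
        by (intro sum.cong) auto
      also have "\<dots> = Af q (cl i) a" using cl[OF p(2)] by (simp add: sum.delta)
      finally have 1: "(\<Sum>b<N. of_bool (cl i = b) * Af q b a) = Af q (cl i) a" .
      have "M p q - of_bool (p = q) = (\<Sum>j\<in>W. Kf q i j * (x j a - of_bool (cl j = a))) +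
         (\<Sum>b<N. (x i b - of_bool (cl i = b)) * Af q b a)"
        unfolding p(1) basis[OF qI p(2,3)] M_def fst_conv snd_conv
        by (simp only: right_diff_distrib left_diff_distrib sum_subtractf 1)
      also have "\<bar>\<dots>\<bar> \<le> (\<Sum>j\<in>W. B * \<delta>) + (\<Sum>b<N. \<delta> * B)"
      proof (intro order_trans[OF abs_triangle_ineq] add_mono order_trans[OF sum_abs] sum_mono)
        fix j assume j: "j \<in> W"
        show "\<bar>Kf q i j * (x j a - of_bool (cl j = a))\<bar> \<le> B * \<delta>"
          unfolding abs_mult using BK[OF qI p(2) j] near[OF j p(3)] B by (intro mult_mono) auto
      next
        fix b assume b: "b \<in> {..<N}"
        then have b': "b < N" by simp
        show "\<bar>(x i b - of_bool (cl i = b)) * Af q b a\<bar> \<le> \<delta> * B"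
          unfolding abs_mult using BA[OF qI b' p(3)] near[OF p(2) b'] \<delta>(1) by (intro mult_mono) auto
      qed
      finally show ?thesis by (simp add: m_def n_def algebra_simps)
    qed
    have gsmall: "\<bar>g p\<bar> \<le> \<delta> * (m * B)" if pI: "p \<in> I" for p
    proof -
      obtain i a where p: "p = (i, a)" "i \<in> W" "a < N" using pI by (auto simp: I_def)
      have "g p = - (\<Sum>j\<in>W. lap i j * (x j a - of_bool (cl j = a)))"
        using lap_row[OF p(2), of a] by (simp add: g_def p(1) right_diff_distrib sum_subtractf)
      then have "\<bar>g p\<bar> = \<bar>\<Sum>j\<in>W. lap i j * (x j a - of_bool (cl j = a))\<bar>" by simp
      also have "\<dots> \<le> (\<Sum>j\<in>W. B * \<delta>)"
      proof (intro order_trans[OF sum_abs] sum_mono)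
        fix j assume j: "j \<in> W"
        show "\<bar>lap i j * (x j a - of_bool (cl j = a))\<bar> \<le> B * \<delta>"
          unfolding abs_mult using BL[OF p(2) j] near[OF j p(3)] B by (intro mult_mono) auto
      qed
      finally show ?thesis by (simp add: m_def algebra_simps)
    qed
    have "\<exists>h. (\<forall>p\<in>I. (\<Sum>q\<in>I. M p q * h q) = g p) \<and> (\<forall>p\<in>I. \<bar>h p\<bar> \<le> 2 * (\<delta> * (m * B)))"
    proof (rule near_identity_solvable[OF finI Mnear _ gsmall])
      show "\<delta> * (m * B + n * B) * real (card I) \<le> 1 / 2"
        using \<delta>(2) by (simp add: cardI mult.assoc)
    qed
    then obtain h where h: "\<And>p. p \<in> I \<Longrightarrow> (\<Sum>q\<in>I. M p q * h q) = g p"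
      "\<And>p. p \<in> I \<Longrightarrow> \<bar>h p\<bar> \<le> 2 * (\<delta> * (m * B))" by blast
    define D where "D i j = (\<Sum>q\<in>I. h q * Kf q i j)" for i j
    define K where "K i j = lap i j + D i j" for i j
    define A where "A a b = (\<Sum>q\<in>I. h q * Af q a b)" for a b
    have patK: "pattern K"
      unfolding K_def D_def by (intro pattern_add pattern_lap pattern_sum finI pattern_scale Kf)
    have symK: "K i j = K j i" for i j using patK unfolding pattern_def by blast
    have Kx: "(\<Sum>j\<in>W. K i j * x j a) = 0" if "i \<in> W" "a < N" for i a
    proof (rule antisymmetric_correction_vanishes[OF symK _ _ that])
      show "A a b = - A b a" for a b
        unfolding A_def sum_negf[symmetric]
      proof (intro sum.cong refl)
        fix q assume "q \<in> I"
        then show "h q * Af q a b = - (h q * Af q b a)" using Af[of q a b] by simp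
      qed
      fix i a assume ia: "i \<in> W" "a < N"
      have 1: "(\<Sum>j\<in>W. D i j * x j a) = (\<Sum>q\<in>I. (\<Sum>j\<in>W. Kf q i j * x j a) * h q)"
        unfolding D_def sum_distrib_right by (subst sum.swap) (simp add: mult_ac)
      have 2: "(\<Sum>b<N. x i b * A b a) = (\<Sum>q\<in>I. (\<Sum>b<N. x i b * Af q b a) * h q)"
        unfolding A_def sum_distrib_right sum_distrib_left by (subst sum.swap) (simp add: mult_ac)
      have "(i, a) \<in> I" using ia by (simp add: I_def)
      from h(1)[OF this] have "(\<Sum>j\<in>W. D i j * x j a) + (\<Sum>b<N. x i b * A b a) = - (\<Sum>j\<in>W. lap i j * x j a)"
        unfolding 1 2 by (simp add: M_def g_def distrib_right sum.distrib)
      then show "(\<Sum>j\<in>W. K i j * x j a) = - (\<Sum>b<N. x i b * A b a)"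
        by (simp add: K_def distrib_right sum.distrib)
    qed
    have Dsmall: "\<bar>D i j\<bar> \<le> \<epsilon>" if "i \<in> W" "j \<in> W" for i j
    proof -
      have "\<bar>D i j\<bar> \<le> (\<Sum>q\<in>I. 2 * (\<delta> * (m * B)) * B)"
        unfolding D_def
      proof (intro order_trans[OF sum_abs] sum_mono)
        fix q assume q: "q \<in> I"
        show "\<bar>h q * Kf q i j\<bar> \<le> 2 * (\<delta> * (m * B)) * B"
          unfolding abs_mult using h(2)[OF q] BK[OF q that] \<delta>(1) m B by (intro mult_mono) auto
      qed
      also have "\<dots> = \<delta> * (m * n * (2 * (m * B)) * B)" using cardI by simp
      finally show ?thesis using \<delta>(3) by linarith
    qed
    \<comment> \<open>Half of the energy from \<open>lap\<close>, less at most a quarter for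
      \<open>D\<close>. The normalisation at the roots is needed to estimate the second part by the
      energy.\<close>
    have coercive: "energy v / 4 \<le> (\<Sum>i\<in>W. \<Sum>j\<in>W. v i * K i j * v j)" if v: "\<forall>a<N. v (r a) = 0" for v
    proof -
      define s where "s = C * sqrt (energy v)"
      have s: "s \<ge> 0" using C(1) energy_nonneg by (simp add: s_def)
      have "\<bar>\<Sum>i\<in>W. \<Sum>j\<in>W. v i * D i j * v j\<bar> \<le> (\<Sum>i\<in>W. \<Sum>j\<in>W. s * \<epsilon> * s)"
      proof (intro order_trans[OF sum_abs] sum_mono)
        fix i j assume "i \<in> W" "j \<in> W"
        then show "\<bar>v i * D i j * v j\<bar> \<le> s * \<epsilon> * s"
          unfolding abs_mult s_def using C(2)[OF v] Dsmall s \<epsilon> unfolding s_def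
          by (intro mult_mono) auto
      qed
      also have "\<dots> = m\<^sup>2 * C\<^sup>2 * \<epsilon> * energy v"
        using energy_nonneg[of v] by (simp add: m_def s_def power2_eq_square algebra_simps)
      also have "\<dots> \<le> 1 / 4 * energy v"
        by (rule mult_right_mono[OF \<epsilon>' energy_nonneg])
      finally have "\<bar>\<Sum>i\<in>W. \<Sum>j\<in>W. v i * D i j * v j\<bar> \<le> energy v / 4" by simp
      moreover have "(\<Sum>i\<in>W. \<Sum>j\<in>W. v i * K i j * v j) =
          (\<Sum>i\<in>W. \<Sum>j\<in>W. v i * lap i j * v j) + (\<Sum>i\<in>W. \<Sum>j\<in>W. v i * D i j * v j)"
        by (simp add: K_def distrib_left distrib_right sum.distrib)
      ultimately show ?thesis using lap_energy[of v] by linarith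
    qed
    have psd: "0 \<le> (\<Sum>i\<in>W. \<Sum>j\<in>W. v i * K i j * v j)" for v
    proof -
      \<comment> \<open>Some combination of the columns of \<open>x\<close> agrees with
        \<open>v\<close> at the roots. These columns lie in the kernel of K, so subtracting the
        combination leaves the form unchanged and brings \<open>v\<close> into the range of
        \<open>coercive\<close>.\<close>
      have "\<exists>t. (\<forall>a\<in>{..<N}. (\<Sum>b\<in>{..<N}. x (r a) b * t b) = v (r a)) \<and>
          (\<forall>a\<in>{..<N}. \<bar>t a\<bar> \<le> 2 * (\<Sum>a<N. \<bar>v (r a)\<bar>))"
      proof (rule near_identity_solvable)
        show "\<bar>x (r a) b - of_bool (a = b)\<bar> \<le> \<delta>" if "a \<in> {..<N}" "b \<in> {..<N}" for a b
          using near[of "r a" b] root that by simp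
        show "\<delta> * real (card {..<N}) \<le> 1 / 2"
          using \<delta>(4) n by (simp add: n_def field_simps)
        show "\<bar>v (r a)\<bar> \<le> (\<Sum>a<N. \<bar>v (r a)\<bar>)" if "a \<in> {..<N}" for a
          using that by (intro member_le_sum[of a _ "\<lambda>a. \<bar>v (r a)\<bar>"]) auto
      qed simp
      then obtain t where t: "\<And>a. a < N \<Longrightarrow> (\<Sum>b<N. x (r a) b * t b) = v (r a)" by auto
      define y where "y i = (\<Sum>b<N. x i b * t b)" for i
      define w where "w i = v i - y i" for i
      have Ky: "(\<Sum>j\<in>W. K i j * y j) = 0" if "i \<in> W" for i
      proof -
        have "(\<Sum>j\<in>W. K i j * y j) = (\<Sum>b<N. (\<Sum>j\<in>W. K i j * x j b) * t b)"
          unfolding y_def sum_distrib_left sum_distrib_right by (subst sum.swap) (simp add: mult_ac)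
        then show ?thesis using Kx[OF that] by simp
      qed
      have Ky1: "(\<Sum>i\<in>W. \<Sum>j\<in>W. u i * K i j * y j) = 0" for u
      proof -
        have "(\<Sum>j\<in>W. u i * K i j * y j) = u i * (\<Sum>j\<in>W. K i j * y j)" for i
          by (simp add: sum_distrib_left mult.assoc)
        then show ?thesis using Ky by simp
      qed
      have Ky2: "(\<Sum>i\<in>W. \<Sum>j\<in>W. y i * K i j * u j) = 0" for u
      proof -
        have "(\<Sum>i\<in>W. \<Sum>j\<in>W. y i * K i j * u j) = (\<Sum>j\<in>W. \<Sum>i\<in>W. u j * K j i * y i)"
          by (subst sum.swap) (simp add: symK mult_ac)
        then show ?thesis using Ky1 by simp
      qed
      have "(\<Sum>i\<in>W. \<Sum>j\<in>W. v i * K i j * v j) = (\<Sum>i\<in>W. \<Sum>j\<in>W. w i * K i j * w j)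
          + (\<Sum>i\<in>W. \<Sum>j\<in>W. v i * K i j * y j) + (\<Sum>i\<in>W. \<Sum>j\<in>W. y i * K i j * w j)"
        unfolding sum.distrib[symmetric] by (intro sum.cong refl) (simp add: w_def algebra_simps)
      moreover have "\<forall>a<N. w (r a) = 0" using t by (simp add: w_def y_def)
      from coercive[OF this] have "0 \<le> (\<Sum>i\<in>W. \<Sum>j\<in>W. w i * K i j * w j)"
        using energy_nonneg[of w] by linarith
      ultimately show ?thesis using Ky1 Ky2 by simp
    qed
    have nz: "\<exists>i j. K i j \<noteq> 0"
    proof (rule ccontr)
      assume "\<not> ?thesis"
      then have K0: "K i j = 0" for i j by blast
      obtain k where k: "k \<in> W" "k \<noteq> r (cl k)" using nontrivial by blast
      \<comment> \<open>This function vanishes at all roots; if K were zero, \<open>coercive\<close>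
        and the Poincare inequality would force it to vanish at \<open>k\<close> too.\<close>
      define u where "u i = (of_bool (i = k) :: real)" for i
      have u: "\<forall>a<N. u (r a) = 0" using k root by (auto simp: u_def)
      have "energy u \<le> 0" using coercive[OF u] K0 by simp
      then have "sqrt (energy u) = 0" using energy_nonneg[of u] by simp
      then have "\<bar>u k\<bar> \<le> 0" using C(2)[OF u k(1)] by simp
      then show False by (simp add: u_def)
    qed
    show "\<exists>K. pattern K \<and> (\<forall>v. 0 \<le> (\<Sum>i\<in>W. \<Sum>j\<in>W. v i * K i j * v j)) \<and> (\<exists>i j. K i j \<noteq> 0) \<and>
        (\<forall>i\<in>W. \<forall>a<N. (\<Sum>j\<in>W. K i j * x j a) = 0)"
      using patK psd nz Kx by blast
  qed (rule \<delta>(1))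
qed

end

section \<open>Cuts in random graphs\<close>

lemma mle_exists_as_full_sample:
  assumes "n > 0" shows "mle_exists_as n E n"
  unfolding mle_exists_as_def
proof (intro allI impI)
  fix \<mu> assume "ac_distribution n \<mu>"
  then have "AE X in Pi\<^sub>M {..<n} (\<lambda>_. \<mu>). Determinant.det (Matrix.mat n n (\<lambda>(r, c). X r c)) \<noteq> (0::real)"
    by (rule AE_data_det_nonzero) simp
  then show "AE X in Pi\<^sub>M {..<n} (\<lambda>_. \<mu>). mle_exists n E n X"
    by eventually_elim (rule mle_exists_of_invertible_data[OF assms])
qed

text \<open>The full sample of size \<open>n\<close> witnesses that the \<open>LEAST\<close> is
  attained, so \<open>mlt n E\<close> itself is positive and qualifies; by assumption it cannot be
  below \<open>d\<close>.\<close>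

lemma mlt_geI:
  assumes "n > 0" and no: "\<And>N. 0 < N \<Longrightarrow> N < d \<Longrightarrow> \<not> mle_exists_as n E N"
  shows "d \<le> mlt n E"
proof -
  have "0 < n \<and> mle_exists_as n E n" using assms mle_exists_as_full_sample by blast
  then have "0 < mlt n E \<and> mle_exists_as n E (mlt n E)"
    unfolding mlt_def by (rule LeastI)
  then show ?thesis using no[of "mlt n E"] by force
qed

text \<open>The set reachable from \<open>i\<close> and its complement are both uncrossed, and one
  of them has at most half of the vertices. Having to cross only small cuts is what keeps the union
  bound summable.\<close>

lemma connected_if_cuts_crossed:
  assumes fin: "finite S" and sym: "\<And>i j. (i, j) \<in> R \<Longrightarrow> (j, i) \<in> R"
    and cut: "\<And>U. U \<subseteq> S \<Longrightarrow> U \<noteq> {} \<Longrightarrow> 2 * card U \<le> card S \<Longrightarrow> \<exists>i\<in>U. \<exists>j\<in>S - U. (i, j) \<in> R"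
    and ij: "i \<in> S" "j \<in> S"
  shows "(i, j) \<in> R\<^sup>*"
proof (rule ccontr)
  assume n: "(i, j) \<notin> R\<^sup>*"
  define U where "U = {k\<in>S. (i, k) \<in> R\<^sup>*}"
  have U: "U \<subseteq> S" "i \<in> U" "j \<in> S - U" using ij n by (auto simp: U_def)
  have closed: "l \<in> U" if "k \<in> U" "l \<in> S" "(k, l) \<in> R" for k l
    using that by (auto simp: U_def intro: rtrancl_into_rtrancl)
  have "card U + card (S - U) = card S"
    using U(1) fin by (metis card_Diff_subset card_mono finite_subset le_add_diff_inverse)
  then consider "2 * card U \<le> card S" | "2 * card (S - U) \<le> card S" by linarith
  then show False
  proof cases
    case 1
    then obtain k l where "k \<in> U" "l \<in> S - U" "(k, l) \<in> R" using cut[of U] U by blast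
    then show False using closed by blast
  next
    case 2
    then obtain k l where "k \<in> S - U" "l \<in> S - (S - U)" "(k, l) \<in> R" using cut[of "S - U"] U by blast
    then show False using closed[of l k] sym[of k l] by blast
  qed
qed

section \<open>Blocks of vertices and the cuts to be crossed\<close>

definition block :: "nat \<Rightarrow> nat \<Rightarrow> nat set" where
  "block m a = {a * m..<Suc a * m}"

text \<open>The potential edges crossing the cut \<open>U\<close> in the complete graph on a block (\<open>a = b\<close>) or in the
  complete bipartite graph between two blocks (\<open>a \<noteq> b\<close>).\<close>

definition cut_pairs :: "nat \<Rightarrow> nat \<Rightarrow> nat \<Rightarrow> nat set \<Rightarrow> (nat \<times> nat) set" where
  "cut_pairs m a b U = {(i, j). i \<in> U \<and> j \<in> (block m a \<union> block m b) - U \<and> (a = b \<or> i div m \<noteq> j div m)}"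

definition small_cuts :: "nat \<Rightarrow> nat \<Rightarrow> nat \<Rightarrow> nat set set" where
  "small_cuts m a b = {U. U \<subseteq> block m a \<union> block m b \<and> U \<noteq> {} \<and> 2 * card U \<le> card (block m a \<union> block m b)}"

lemma block_div: "i \<in> block m a \<longleftrightarrow> m > 0 \<and> i div m = a"
proof (cases "m > 0")
  case True
  then have "i div m = a \<longleftrightarrow> a * m \<le> i \<and> i < Suc a * m"
    by (metis div_less_iff_less_mult le_antisym less_Suc_eq_le less_eq_div_iff_mult_less_eq lessI)
  with True show ?thesis by (simp add: block_def)
qed (simp add: block_def)

lemma finite_block: "finite (block m a)" and card_block: "card (block m a) = m"
  by (simp_all add: block_def)

lemma block_subset: "a < D \<Longrightarrow> D * m \<le> n \<Longrightarrow> block m a \<subseteq> {..<n}"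
proof -
  assume "a < D" "D * m \<le> n"
  then have "Suc a * m \<le> D * m" by (intro mult_le_mono1) simp
  with \<open>D * m \<le> n\<close> show ?thesis by (auto simp: block_def)
qed

text \<open>For a sample size N below \<open>d\<close> the first N blocks form a rigid partition.
  Vertices outside them carry zero rows of the stress, so their data are irrelevant.\<close>

lemma mlt_ge_if_cuts_crossed:
  assumes m: "m \<ge> 2" and n: "d * m \<le> n" "n > 0"
    and cut: "\<And>a b U. a < d \<Longrightarrow> b < d \<Longrightarrow> U \<in> small_cuts m a b \<Longrightarrow>
      \<exists>(i, j)\<in>cut_pairs m a b U. {i, j} \<in> E"
  shows "d \<le> mlt n E"
proof (rule mlt_geI[OF n(2)])
  fix N assume N: "0 < N" "N < d"
  define W where "W = {..<N * m}"
  define R where "R a b = {(i, j). i \<in> block m a \<union> block m b \<and> j \<in> block m a \<union> block m b \<and> i \<noteq> j \<and> {i, j} \<in> E \<and>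
     (a = b \<or> i div m \<noteq> j div m)}" for a b
  have conn: "(i, j) \<in> (R a b)\<^sup>*"
    if ab: "a < d" "b < d" and ij: "i \<in> block m a \<union> block m b" "j \<in> block m a \<union> block m b" for a b i j
  proof (rule connected_if_cuts_crossed[OF _ _ _ ij])
    show "finite (block m a \<union> block m b)" by (simp add: finite_block)
    show "(k, i) \<in> R a b" if "(i, k) \<in> R a b" for i k
      using that by (auto simp: R_def insert_commute)
    fix U assume U: "U \<subseteq> block m a \<union> block m b" "U \<noteq> {}" "2 * card U \<le> card (block m a \<union> block m b)"
    then have "U \<in> small_cuts m a b" by (simp add: small_cuts_def)
    then obtain k l where "(k, l) \<in> cut_pairs m a b U" "{k, l} \<in> E" using cut[OF ab] by blast
    then show "\<exists>i\<in>U. \<exists>j\<in>block m a \<union> block m b - U. (i, j) \<in> R a b"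
      using U(1) by (auto simp: cut_pairs_def R_def)
  qed
  have inW: "i \<in> W \<longleftrightarrow> i div m < N" for i
    using m by (simp add: W_def div_less_iff_less_mult)
  have mpos: "m > 0" using m by simp
  interpret rigid_partition W E "\<lambda>i. i div m" N "\<lambda>a. a * m"
  proof
    show "finite W" by (simp add: W_def)
    show "i div m < N" if "i \<in> W" for i using that inW by simp
    show "a * m \<in> W" "a * m div m = a" if "a < N" for a using that m by (simp_all add: inW)
    show "(i div m * m, i) \<in> {(i, j). i \<in> W \<and> j \<in> W \<and> i \<noteq> j \<and> {i, j} \<in> E \<and> i div m = j div m}\<^sup>*" if "i \<in> W" for i
    proof -
      have a: "i div m < N" using that inW by simp
      have path: "(i div m * m, i) \<in> (R (i div m) (i div m))\<^sup>*"
        using a N mpos by (intro conn) (auto simp: block_div)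
      have "R (i div m) (i div m) \<subseteq> {(i, j). i \<in> W \<and> j \<in> W \<and> i \<noteq> j \<and> {i, j} \<in> E \<and> i div m = j div m}"
        using a by (auto simp: R_def block_div inW)
      from subsetD[OF rtrancl_mono[OF this] path] show ?thesis .
    qed
    show "(i, j) \<in> {(i, j). i \<in> W \<and> j \<in> W \<and> {i, j} \<in> E \<and> i div m \<noteq> j div m \<and> i div m \<in> {a, b} \<and> j div m \<in> {a, b}}\<^sup>*"
      if "a < N" "b < N" "a \<noteq> b" "i \<in> W" "j \<in> W" "i div m \<in> {a, b}" "j div m \<in> {a, b}" for a b i j
    proof -
      have path: "(i, j) \<in> (R a b)\<^sup>*"
        using that N mpos by (intro conn) (auto simp: block_div)
      have "R a b \<subseteq> {(i, j). i \<in> W \<and> j \<in> W \<and> {i, j} \<in> E \<and> i div m \<noteq> j div m \<and> i div m \<in> {a, b} \<and> j div m \<in> {a, b}}"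
        using that by (auto simp: R_def block_div inW)
      from subsetD[OF rtrancl_mono[OF this] path] show ?thesis .
    qed
    show "\<exists>v\<in>W. v \<noteq> v div m * m"
    \<comment> \<open>The root of block 0 is the vertex 0; since blocks have at least two vertices,
      1 lies in the same block and is not a root.\<close>
    proof (intro bexI[of _ 1])
      have "1 div m = 0" using m by simp
      then show "1 \<noteq> 1 div m * m" "1 \<in> W" using N by (simp_all add: inW)
    qed
  qed
  have Wn: "W \<subseteq> {..<n}"
  proof -
    have "N * m \<le> d * m" using N by (intro mult_le_mono1) simp
    from order_trans[OF this n(1)] show ?thesis by (simp add: W_def)
  qed
  obtain \<delta> where \<delta>: "\<delta> > 0" and stress: "\<forall>x. (\<forall>i\<in>W. \<forall>a<N. \<bar>x i a - of_bool (i div m = a)\<bar> \<le> \<delta>) \<longrightarrow>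
      (\<exists>K. pattern K \<and> (\<forall>v. 0 \<le> (\<Sum>i\<in>W. \<Sum>j\<in>W. v i * K i j * v j)) \<and> (\<exists>i j. K i j \<noteq> 0) \<and>
        (\<forall>i\<in>W. \<forall>a<N. (\<Sum>j\<in>W. K i j * x j a) = 0))"
    using stress_near_partition by (elim exE conjE)
  show "\<not> mle_exists_as n E N"
  \<comment> \<open>The centre of the box: sample \<open>k\<close> is the indicator of block
    \<open>k\<close>.\<close>
  proof (rule not_mle_exists_as_if_box[OF \<delta>, of N n "\<lambda>k i. of_bool (i div m = k)"])
    fix X :: "nat \<Rightarrow> nat \<Rightarrow> real"
    assume X: "\<And>k i. k < N \<Longrightarrow> i < n \<Longrightarrow> \<bar>X k i - of_bool (i div m = k)\<bar> \<le> \<delta>"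
    have "\<forall>i\<in>W. \<forall>a<N. \<bar>X a i - of_bool (i div m = a)\<bar> \<le> \<delta>"
    proof (intro ballI allI impI)
      fix i a assume "i \<in> W" "a < N"
      then show "\<bar>X a i - of_bool (i div m = a)\<bar> \<le> \<delta>" using Wn by (intro X) auto
    qed
    then obtain K where K: "pattern K" "\<forall>v. 0 \<le> (\<Sum>i\<in>W. \<Sum>j\<in>W. v i * K i j * v j)" "\<exists>i j. K i j \<noteq> 0"
        "\<forall>i\<in>W. \<forall>a<N. (\<Sum>j\<in>W. K i j * X a j) = 0"
      using stress[rule_format, of "\<lambda>i a. X a i"] by blast
    have supp: "i \<in> W \<and> j \<in> W \<and> (i = j \<or> {i, j} \<in> E)" if "K i j \<noteq> 0" for i j
      using K(1) that unfolding pattern_def by blast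
    have zero: "K i j = 0" if "i \<notin> W \<or> j \<notin> W" for i j using supp that by blast
    have restr: "(\<Sum>j<n. f j) = (\<Sum>j\<in>W. f j)" if "\<And>j. j \<notin> W \<Longrightarrow> f j = 0" for f :: "nat \<Rightarrow> real"
      using that Wn by (intro sum.mono_neutral_right) auto
    show "\<not> mle_exists n E N X"
    proof (rule stress_not_mle_exists)
      show "K i j = K j i" for i j using K(1) unfolding pattern_def by blast
      show "i < n \<and> j < n \<and> (i = j \<or> {i, j} \<in> E)" if "K i j \<noteq> 0" for i j
        using supp[OF that] Wn by blast
      show "0 \<le> (\<Sum>i<n. \<Sum>j<n. v i * K i j * v j)" for v
      proof -
        have "(\<Sum>i<n. \<Sum>j<n. v i * K i j * v j) = (\<Sum>i\<in>W. \<Sum>j\<in>W. v i * K i j * v j)"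
          by (simp add: restr zero)
        with K(2) show ?thesis by simp
      qed
      show "\<exists>i j. K i j \<noteq> 0" by (rule K(3))
      show "(\<Sum>j<n. K i j * X k j) = 0" if "i < n" "k < N" for i k
      proof (cases "i \<in> W")
        case True
        then show ?thesis using K(4) that by (simp add: restr zero)
      qed (simp add: zero)
    qed
  qed
qed

text \<open>A linear lower bound in \<open>card U\<close> makes the probability of an uncrossed cut
  a power with exponent \<open>card U\<close>. Inside one block the count is u (m - u) with u at
  most m/2; between two blocks it is s (m - t) + t (m - s) with s + t at most m.\<close>

lemma card_cut_pairs:
  assumes U: "U \<in> small_cuts m a b" and m: "m > 0"
  shows "m * card U \<le> 2 * card (cut_pairs m a b U)"
proof -
  have sub: "U \<subseteq> block m a \<union> block m b" and small: "2 * card U \<le> card (block m a \<union> block m b)"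
    using U by (auto simp: small_cuts_def)
  have fU: "finite U" using sub finite_block by (meson finite_UnI finite_subset)
  show ?thesis
  proof (cases "a = b")
    case True
    define u where "u = card U"
    have "cut_pairs m a b U = U \<times> (block m a - U)" using True by (auto simp: cut_pairs_def)
    then have "card (cut_pairs m a b U) = u * (m - u)"
      using sub True fU by (simp add: card_cartesian_product card_Diff_subset card_block u_def)
    moreover have "2 * u \<le> m" using small True by (simp add: card_block u_def)
    then have "u * m \<le> u * (2 * (m - u))" by (intro mult_le_mono2) simp
    ultimately show ?thesis by (simp add: u_def mult_ac)
  next
    case False
    then have disj: "block m a \<inter> block m b = {}" by (auto simp: block_div)
    define S T where "S = U \<inter> block m a" and "T = U \<inter> block m b"
    define s t where "s = card S" and "t = card T"
    have fin: "finite S" "finite T" using fU by (auto simp: S_def T_def)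
    have "U = S \<union> T" "S \<inter> T = {}" using sub disj by (auto simp: S_def T_def)
    then have u: "card U = s + t" using fin by (simp add: card_Un_disjoint s_def t_def)
    have "card (block m a \<union> block m b) = 2 * m"
      using disj by (simp add: card_Un_disjoint finite_block card_block)
    then have st: "s + t \<le> m" using small u by simp
    have "cut_pairs m a b U = S \<times> (block m b - T) \<union> T \<times> (block m a - S)"
      using sub False unfolding S_def T_def cut_pairs_def by (auto simp: block_div)
    moreover have "S \<times> (block m b - T) \<inter> T \<times> (block m a - S) = {}"
      using disj by (auto simp: S_def T_def)
    ultimately have "card (cut_pairs m a b U) = s * (m - t) + t * (m - s)"
      using fin by (simp add: card_Un_disjoint card_cartesian_product finite_block card_Diff_subset card_block s_def t_def S_def T_def)
    moreover have "m * (s + t) \<le> 2 * (s * (m - t) + t * (m - s))"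
    proof -
      \<comment> \<open>It amounts to 4 s t <= (s + t)^2 <= m (s + t). Integers avoid truncated
        subtraction.\<close>
      have "int m * (int s + int t) \<le> 2 * (int s * (int m - int t) + int t * (int m - int s))"
      proof -
        have "(int s + int t) * (int s + int t) \<le> int m * (int s + int t)"
          using st by (intro mult_right_mono) auto
        moreover have "0 \<le> (int s - int t) * (int s - int t)" by simp
        ultimately show ?thesis by (simp add: algebra_simps)
      qed
      also have "\<dots> = int (2 * (s * (m - t) + t * (m - s)))" using st by (simp add: of_nat_diff)
      finally show ?thesis by (metis of_nat_add of_nat_le_iff of_nat_mult)
    qed
    ultimately show ?thesis by (simp add: u)
  qed
qed

section \<open>The union bound over uncrossed cuts\<close>

lemma sum_power_card_Pow:
  fixes t :: "'a :: comm_semiring_1"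
  assumes "finite S" shows "(\<Sum>U\<in>Pow S. t ^ card U) = (1 + t) ^ card S"
  using assms
proof (induction S rule: finite_induct)
  case (insert x S)
  have "(\<Sum>U\<in>Pow (insert x S). t ^ card U) = (\<Sum>U\<in>Pow S. t ^ card U) + (\<Sum>U\<in>insert x ` Pow S. t ^ card U)"
    unfolding Pow_insert using insert by (intro sum.union_disjoint) auto
  also have "(\<Sum>U\<in>insert x ` Pow S. t ^ card U) = (\<Sum>U\<in>Pow S. t ^ card (insert x U))"
    using insert by (intro sum.reindex_cong[of "insert x"]) (auto simp: inj_on_def)
  also have "\<dots> = (\<Sum>U\<in>Pow S. t * t ^ card U)"
  proof (intro sum.cong refl)
    fix U assume "U \<in> Pow S"
    then have "finite U" "x \<notin> U" using insert by (auto intro: finite_subset)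
    then show "t ^ card (insert x U) = t * t ^ card U" by simp
  qed
  finally show ?case using insert by (simp add: sum_distrib_left[symmetric] distrib_right)
qed simp

lemma finite_all_edges: "finite (all_edges n)"
  unfolding all_edges_def by (rule finite_subset[of _ "Pow {..<n}"]) auto

lemma prob_no_edge:
  assumes F: "F \<subseteq> all_edges n" and p: "0 \<le> p" "p \<le> 1"
  shows "measure_pmf.prob (erdos_renyi n p) {E. E \<inter> F = {}} = (1 - p) ^ card F"
proof -
  have "measure_pmf.prob (erdos_renyi n p) {E. E \<inter> F = {}} =
     measure_pmf.prob (Pi_pmf (all_edges n) False (\<lambda>_. bernoulli_pmf p)) (Pi (all_edges n) (\<lambda>e. if e \<in> F then {False} else UNIV))"
    unfolding erdos_renyi_def measure_map_pmf
    by (intro arg_cong[of _ _ "measure_pmf.prob _"]) (use F in \<open>auto simp: Pi_def split: if_splits\<close>)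
  also have "\<dots> = (\<Prod>e\<in>all_edges n. measure_pmf.prob (bernoulli_pmf p) (if e \<in> F then {False} else UNIV))"
    by (rule measure_Pi_pmf_Pi[OF finite_all_edges])
  also have "\<dots> = (\<Prod>e\<in>all_edges n. if e \<in> F then 1 - p else 1)"
    using p by (intro prod.cong) (auto simp: measure_pmf_single)
  also have "\<dots> = (1 - p) ^ card F"
    using F finite_all_edges by (simp add: prod.If_cases Int_absorb1)
  finally show ?thesis .
qed

text \<open>By independence and 1 - p <= exp (- p), a cut \<open>U\<close> is uncrossed with
  probability at most t^|U|. Summed over nonempty sets, these weights give (1 + t)^|S| - 1 by the
  binomial theorem, so cuts need not be grouped by size.\<close>

lemma prob_uncrossed_cut:
  assumes p: "0 \<le> p" "p \<le> 1" and ab: "a < d" "b < d" and m: "m > 0" "d * m \<le> n"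
  shows "measure_pmf.prob (erdos_renyi n p) {E. \<exists>U\<in>small_cuts m a b. \<forall>(i, j)\<in>cut_pairs m a b U. {i, j} \<notin> E}
     \<le> exp (2 * real m * exp (- p * real m / 2)) - 1"
proof -
  define S where "S = block m a \<union> block m b"
  define t where "t = exp (- p * real m / 2)"
  define F where "F U = (\<lambda>(i, j). {i, j}) ` cut_pairs m a b U" for U
  have finS: "finite S" by (simp add: S_def finite_block)
  have Sn: "S \<subseteq> {..<n}" unfolding S_def using block_subset ab m(2) by blast
  have sc: "small_cuts m a b \<subseteq> Pow S - {{}}" by (auto simp: small_cuts_def S_def)
  have fin: "finite (small_cuts m a b)" using sc finS by (meson finite_Diff finite_Pow_iff finite_subset)
  have one: "measure_pmf.prob (erdos_renyi n p) {E. \<forall>(i, j)\<in>cut_pairs m a b U. {i, j} \<notin> E} \<le> t ^ card U"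
    if U: "U \<in> small_cuts m a b" for U
  proof -
    have sub: "U \<subseteq> S" using U sc by blast
    have "inj_on (\<lambda>(i, j). {i, j}) (cut_pairs m a b U)"
      by (auto simp: inj_on_def cut_pairs_def doubleton_eq_iff)
    then have cardF: "card (F U) = card (cut_pairs m a b U)" unfolding F_def by (rule card_image)
    have FE: "F U \<subseteq> all_edges n"
    proof
      fix e assume "e \<in> F U"
      then obtain i j where ij: "e = {i, j}" "i \<in> U" "j \<in> S" "j \<notin> U" by (auto simp: F_def cut_pairs_def S_def)
      then have "i \<noteq> j" by blast
      with ij sub Sn show "e \<in> all_edges n" by (auto simp: all_edges_def)
    qed
    have "{E. \<forall>(i, j)\<in>cut_pairs m a b U. {i, j} \<notin> E} = {E. E \<inter> F U = {}}" by (auto simp: F_def)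
    then have "measure_pmf.prob (erdos_renyi n p) {E. \<forall>(i, j)\<in>cut_pairs m a b U. {i, j} \<notin> E} = (1 - p) ^ card (F U)"
      using prob_no_edge[OF FE p] by simp
    also have "\<dots> \<le> exp (- p) ^ card (F U)"
      using p exp_ge_add_one_self[of "- p"] by (intro power_mono) auto
    also have "\<dots> = exp (- p * real (card (F U)))" by (simp add: exp_of_nat_mult[symmetric] mult.commute)
    also have "\<dots> \<le> exp (- p * (real m * real (card U) / 2))"
    proof -
      have "real (m * card U) \<le> real (2 * card (F U))"
        using card_cut_pairs[OF U m(1)] unfolding cardF by (rule of_nat_mono)
      then have "real m * real (card U) / 2 \<le> real (card (F U))" by simp
      then have "p * (real m * real (card U) / 2) \<le> p * real (card (F U))"
        by (rule mult_left_mono[OF _ p(1)])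
      then show ?thesis by simp
    qed
    also have "\<dots> = t ^ card U"
      unfolding t_def by (simp add: exp_of_nat_mult[symmetric] algebra_simps)
    finally show ?thesis .
  qed
  have "measure_pmf.prob (erdos_renyi n p) {E. \<exists>U\<in>small_cuts m a b. \<forall>(i, j)\<in>cut_pairs m a b U. {i, j} \<notin> E} =
      measure_pmf.prob (erdos_renyi n p) (\<Union>U\<in>small_cuts m a b. {E. \<forall>(i, j)\<in>cut_pairs m a b U. {i, j} \<notin> E})"
    by (intro arg_cong[of _ _ "measure_pmf.prob _"]) blast
  also have "\<dots> \<le> (\<Sum>U\<in>small_cuts m a b. measure_pmf.prob (erdos_renyi n p) {E. \<forall>(i, j)\<in>cut_pairs m a b U. {i, j} \<notin> E})"
    by (intro measure_pmf.finite_measure_subadditive_finite fin) auto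
  also have "\<dots> \<le> (\<Sum>U\<in>small_cuts m a b. t ^ card U)" by (intro sum_mono one)
  \<comment> \<open>Smallness of the cut has been used in the exponent; dropping it now completes
    the binomial sum.\<close>
  also have "\<dots> \<le> (\<Sum>U\<in>Pow S - {{}}. t ^ card U)"
    using sc finS by (intro sum_mono2) (auto simp: t_def)
  also have "\<dots> = (1 + t) ^ card S - 1"
    using finS by (simp add: sum_diff1 sum_power_card_Pow)
  also have "\<dots> \<le> exp t ^ card S - 1"
    using exp_ge_add_one_self[of t] by (intro diff_right_mono power_mono) (auto simp: t_def)
  also have "\<dots> = exp (real (card S) * t) - 1" by (simp add: exp_of_nat_mult)
  also have "\<dots> \<le> exp (2 * real m * t) - 1"
  proof -
    have "card S \<le> 2 * m" unfolding S_def by (rule order_trans[OF card_Un_le]) (simp add: card_block)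
    then have "real (card S) \<le> 2 * real m" by linarith
    then show ?thesis by (simp add: mult_right_mono t_def)
  qed
  finally show ?thesis by (simp add: t_def)
qed

lemma prob_mlt_ge:
  assumes p: "0 \<le> p" "p \<le> 1" and m: "m \<ge> 2" "d * m \<le> n" "n > 0"
  shows "measure_pmf.prob (erdos_renyi n p) {E. mlt n E \<ge> d}
     \<ge> 1 - real d * real d * (exp (2 * real m * exp (- p * real m / 2)) - 1)"
proof -
  define bad where "bad = (\<lambda>(a, b). {E. \<exists>U\<in>small_cuts m a b. \<forall>(i, j)\<in>cut_pairs m a b U. {i, j} \<notin> E})"
  define B where "B = (\<Union>q\<in>{..<d} \<times> {..<d}. bad q)"
  have "measure_pmf.prob (erdos_renyi n p) B \<le> (\<Sum>q\<in>{..<d} \<times> {..<d}. measure_pmf.prob (erdos_renyi n p) (bad q))"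
    unfolding B_def by (intro measure_pmf.finite_measure_subadditive_finite) auto
  \<comment> \<open>Pairs with equal entries stand for the graphs inside blocks, the others for the
    bipartite graphs.\<close>
  also have "\<dots> \<le> (\<Sum>q\<in>{..<d} \<times> {..<d}. exp (2 * real m * exp (- p * real m / 2)) - 1)"
  proof (rule sum_mono)
    fix q assume "q \<in> {..<d} \<times> {..<d}"
    then show "measure_pmf.prob (erdos_renyi n p) (bad q) \<le> exp (2 * real m * exp (- p * real m / 2)) - 1"
      using prob_uncrossed_cut[OF p _ _ _ m(2)] m(1) by (auto simp: bad_def)
  qed
  also have "\<dots> = real d * real d * (exp (2 * real m * exp (- p * real m / 2)) - 1)"
    by (simp add: card_cartesian_product)
  finally have "1 - real d * real d * (exp (2 * real m * exp (- p * real m / 2)) - 1) \<le> 1 - measure_pmf.prob (erdos_renyi n p) B"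
    by simp
  also have "\<dots> = measure_pmf.prob (erdos_renyi n p) (- B)"
    using measure_pmf.prob_compl[of B "erdos_renyi n p"] by (simp add: Compl_eq_Diff_UNIV)
  also have "\<dots> \<le> measure_pmf.prob (erdos_renyi n p) {E. mlt n E \<ge> d}"
  proof (rule measure_pmf.finite_measure_mono)
    show "- B \<subseteq> {E. mlt n E \<ge> d}"
    proof
      fix E assume E: "E \<in> - B"
      have "d \<le> mlt n E"
      proof (rule mlt_ge_if_cuts_crossed[OF m])
        fix a b U assume "a < d" "b < d" "U \<in> small_cuts m a b"
        then show "\<exists>(i, j)\<in>cut_pairs m a b U. {i, j} \<in> E" using E by (fastforce simp: B_def bad_def)
      qed
      then show "E \<in> {E. mlt n E \<ge> d}" by simp
    qed
  qed simp
  finally show ?thesis .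
qed

theorem mainTheorem7:
  fixes d :: nat
  assumes "d \<ge> 1"
  shows "\<exists>(M::real) (k::nat). M > 0 \<and>
    (\<lambda>n. measure_pmf.prob (erdos_renyi n (M * ln (real n) ^ k / real n)) {E. mlt n E \<ge> d})
      \<longlonglongrightarrow> 1"
proof (intro exI conjI)
  \<comment> \<open>Blocks of size m = n div d have m >= n/(2d), so the factor 8 d gives p m / 2 >=
    2 ln n and hence t <= 1/n^2. Then 2 m t <= 2/n, which tends to 0.\<close>
  define p where "p n = 8 * real d * ln (real n) ^ 1 / real n" for n :: nat
  show "8 * real d > 0" using assms by simp
  have "(\<lambda>n. p n) \<longlonglongrightarrow> 0" unfolding p_def by real_asymp
  then have ev1: "eventually (\<lambda>n. p n < 1) sequentially"
    by (rule order_tendstoD) simp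
  have ev: "eventually (\<lambda>n. 1 - real d * real d * (exp (2 / real n) - 1)
      \<le> measure_pmf.prob (erdos_renyi n (p n)) {E. mlt n E \<ge> d}) sequentially"
    \<comment> \<open>From n >= 2 d on, blocks have the required two vertices; \<open>ev1\<close>
      keeps \<open>p n\<close> where \<open>bernoulli_pmf\<close> does not truncate it.\<close>
    using ev1 eventually_ge_at_top[of "2 * d"]
  proof eventually_elim
    case (elim n)
    have n: "n \<ge> 2" "n > 0" using elim assms by auto
    define m where "m = n div d"
    have m: "m \<ge> 2" using elim(2) assms by (simp add: m_def less_eq_div_iff_mult_less_eq)
    have dm: "d * m \<le> n" by (simp add: m_def)
    have "d * m + n mod d = n" by (simp add: m_def)
    moreover have "n mod d < d" using assms by simp
    moreover have "d * 1 \<le> d * m" using m by (intro mult_le_mono2) simp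
    ultimately have "n \<le> 2 * (d * m)" by linarith
    then have "real n \<le> real (2 * (d * m))" by (rule of_nat_mono)
    then have nm: "real n \<le> 2 * (real d * real m)" by simp
    have p0: "p n \<ge> 0" using n by (simp add: p_def)
    have "2 * ln (real n) \<le> p n * real m / 2"
    proof -
      have "real n * ln (real n) \<le> 2 * (real d * real m) * ln (real n)"
        using nm n by (intro mult_right_mono) auto
      then show ?thesis using n by (simp add: p_def field_simps)
    qed
    then have "exp (- p n * real m / 2) \<le> exp (- (2 * ln (real n)))" by simp
    also have "\<dots> = 1 / (real n * real n)"
    proof -
      have "exp (2 * ln (real n)) = real n * real n"
        unfolding mult_2 exp_add using n by simp
      then show ?thesis by (simp only: exp_minus inverse_eq_divide)
    qed
    finally have "2 * real m * exp (- p n * real m / 2) \<le> 2 * real n * (1 / (real n * real n))"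
      by (intro mult_mono) (auto simp: m_def)
    also have "\<dots> = 2 / real n" using n by simp
    finally have "exp (2 * real m * exp (- p n * real m / 2)) \<le> exp (2 / real n)" by simp
    then have "real d * real d * (exp (2 * real m * exp (- p n * real m / 2)) - 1) \<le> real d * real d * (exp (2 / real n) - 1)"
      by (intro mult_left_mono) auto
    with prob_mlt_ge[OF p0 _ m dm n(2)] elim(1) show ?case by fastforce
  qed
  have "(\<lambda>n. measure_pmf.prob (erdos_renyi n (p n)) {E. mlt n E \<ge> d}) \<longlonglongrightarrow> 1"
  proof (rule tendsto_sandwich[OF ev])
    show "(\<lambda>n. 1 - real d * real d * (exp (2 / real n) - 1)) \<longlonglongrightarrow> 1" by real_asymp
  qed auto
  then show "(\<lambda>n. measure_pmf.prob (erdos_renyi n (8 * real d * ln (real n) ^ 1 / real n)) {E. mlt n E \<ge> d}) \<longlonglongrightarrow> 1"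
    by (simp only: p_def)
qed

end
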